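(* Assume $H=K$. Then, $\mathbb P$-a.s. for every $t\in[0,1]$, $$\lim_{n\uparrow\infty}\frac1{n^{1/(2H)}}\sum_{k=0}^{\lfloor tb^n\rfloor-1}\big|Y((k+1)b^{-n})-Y(kb^{-n})\big|^{1/H}=\frac{2^{1/(2H)}\,\Gamma\big(\frac{H+1}{2H}\big)}{\sqrt\pi}\,t.$$ In particular, almost all sample paths of $Y$ have infinite $b$-adic $(1/H)$-th variation: $\mathbb P$-a.s., for every $t\in(0,1]$, $$V_n^{(1/H)}(Y,t)\longrightarrow+\infty\qquad\text{as } n\to\infty.$$
   Context: Let $(\Omega,\mathcal F,\mathbb P)$ be a probability space, $H\in(0,1)$, and let $W_H=\{W_H(t):0\le t\le 1\}$ be a continuous fractional Brownian motion with Hurst parameter $H$, i.e. a continuous centered Gaussian process with $\mathbb E[W_H(s)W_H(t)]=\frac12(s^{2H}+t^{2H}-|t-s|^{2H})$. Let $\kappa:[0,1]\to[0,1]$ be a deterministic function with $\kappa(0)=0$, $\kappa(1)=1$, Hölder continuous with some exponent $\tau\in(H,1]$, and put $B_H(u):=W_H(u)-\kappa(u)W_H(1)$, $0\le u\le1$. Let $\alpha\in(0,1)$ and $b\in\{2,3,\dots\}$. The fractional Wiener--Weierstrass bridge with parameters $\alpha,b,H$ is $$Y(t):=\sum_{n=0}^\infty\alpha^nB_H(\{b^nt\}),\qquad 0\le t\le1,$$ where $\{x\}$ denotes the fractional part of $x\ge0$. Put $K:=\min\{1,-\log_b\alpha\}$. For a continuous function $f:[0,1]\to\mathbb R$ and $q>0$,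 write $V_n^{(q)}(f,t):=\sum_{k=0}^{\lfloor tb^n\rfloor-1}|f((k+1)b^{-n})-f(kb^{-n})|^q$, $0\le t\le 1$. $\Gamma$ is Euler's gamma function. *)

theory Defs
  imports "HOL-Probability.Probability"
begin

text \<open>Normal random variables, with point masses admitted as the degenerate case of zero variance.
  The degenerate case is needed: a fractional Brownian motion vanishes almost surely at time 0.\<close>

definition gaussian_rv :: "'a measure \<Rightarrow> ('a \<Rightarrow> real) \<Rightarrow> bool" where
  "gaussian_rv M X \<longleftrightarrow> X \<in> borel_measurable M \<and>
     (\<exists>\<mu>. (\<exists>\<sigma>>0. distributed M lborel X (normal_density \<mu> \<sigma>)) \<or> (AE \<omega> in M. X \<omega> = \<mu>))"

definition gaussian_process :: "'a measure \<Rightarrow> real set \<Rightarrow> (real \<Rightarrow> 'a \<Rightarrow> real) \<Rightarrow> bool" where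
  "gaussian_process M T X \<longleftrightarrow>
     (\<forall>J c. finite J \<longrightarrow> J \<subseteq> T \<longrightarrow> gaussian_rv M (\<lambda>\<omega>. \<Sum>t\<in>J. c t * X t \<omega>))"

text \<open>The expectations below are Bochner integrals, which are 0 for non-integrable functions. Here
  all integrands are integrable, since the first conjunct makes every \<open>W t\<close> normally distributed.\<close>

definition continuous_fBm :: "'a measure \<Rightarrow> real \<Rightarrow> (real \<Rightarrow> 'a \<Rightarrow> real) \<Rightarrow> bool" where
  "continuous_fBm M H W \<longleftrightarrow>
     gaussian_process M {0..1} W \<and>
     (\<forall>t\<in>{0..1}. (LINT \<omega>|M. W t \<omega>) = 0) \<and>
     (\<forall>s\<in>{0..1}. \<forall>t\<in>{0..1}.
        (LINT \<omega>|M. W s \<omega> * W t \<omega>)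
          = (s powr (2 * H) + t powr (2 * H) - \<bar>t - s\<bar> powr (2 * H)) / 2) \<and>
     (\<forall>\<omega>\<in>space M. continuous_on {0..1} (\<lambda>t. W t \<omega>))"

definition holder_on :: "real \<Rightarrow> real set \<Rightarrow> (real \<Rightarrow> real) \<Rightarrow> bool" where
  "holder_on \<tau> S f \<longleftrightarrow> (\<exists>C. \<forall>x\<in>S. \<forall>y\<in>S. \<bar>f x - f y\<bar> \<le> C * \<bar>x - y\<bar> powr \<tau>)"

definition bridge :: "(real \<Rightarrow> real) \<Rightarrow> (real \<Rightarrow> 'a \<Rightarrow> real) \<Rightarrow> real \<Rightarrow> 'a \<Rightarrow> real" where
  "bridge \<kappa> W u \<omega> = W u \<omega> - \<kappa> u * W 1 \<omega>"

text \<open>The series converges whenever \<open>\<bar>\<alpha>\<bar> < 1\<close> and the path of \<open>B\<close> is bounded on the unit interval.\<close>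

definition wiener_weierstrass :: "real \<Rightarrow> nat \<Rightarrow> (real \<Rightarrow> 'a \<Rightarrow> real) \<Rightarrow> real \<Rightarrow> 'a \<Rightarrow> real" where
  "wiener_weierstrass \<alpha> b B t \<omega> = (\<Sum>n. \<alpha> ^ n * B (frac (real b ^ n * t)) \<omega>)"

definition weierstrass_exponent :: "real \<Rightarrow> nat \<Rightarrow> real" where
  "weierstrass_exponent \<alpha> b = min 1 (- log (real b) \<alpha>)"

text \<open>The \<open>q\<close>-th variation of \<open>f\<close> along the \<open>n\<close>-th \<open>b\<close>-adic partition, up to time \<open>t \<ge> 0\<close>.\<close>

definition badic_variation :: "nat \<Rightarrow> real \<Rightarrow> nat \<Rightarrow> (real \<Rightarrow> real) \<Rightarrow> real \<Rightarrow> real" where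
  "badic_variation b q n f t =
     (\<Sum>k<nat \<lfloor>t * real b ^ n\<rfloor>.
        \<bar>f ((real k + 1) / real b ^ n) - f (real k / real b ^ n)\<bar> powr q)"

end

(* Write S n k for the increment of Y over the k-th b-adic interval of level n, divided by b^(-nH).
   As H = K < 1 we have alpha = b^(-H), and B_H vanishes at 0 and 1, so S n k is the sum over i = 1..n
   of the normalised increments of B_H over the cell of level i with index k mod b^i. The part coming
   from kappa is bounded in n and k, because tau > H. Hence the rescaled variation is the average over k
   of |S n k / sqrt n|^(1/H), where S n k may be replaced by a Gaussian variable G n k built from
   W_H alone.

   The covariances of G n k and G n l are sums of correlations of increments of W_H at two levels. Each of
   these is a difference of two values of v |-> |v + h|^(2H) - |v|^(2H), a function of small total
   variation, so that summing over all cells of the finer level telescopes. It follows that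
   Var (G n k) / n is close to 1 on average and that the average over k, l of Cov (G n k, G n l)^2 is bounded.
   For the even functions f = cos and f = cosh, the covariance of f X and f Y for jointly Gaussian
   X, Y is of the order of Cov (X, Y)^2; therefore the averages over k of f (theta * G n k / sqrt n) have summable
   variances and converge almost surely. The cosines identify the limit of the empirical
   distributions as the standard normal law (Levy's continuity theorem), the cosh bound gives uniform
   integrability, and monotonicity in t passes from rational to all t. *)
theory Submission
  imports Defs
begin

text \<open>The averages cannot be replaced by pointwise estimates. For k = 0 all cells start at the
  origin, their increments are positively correlated, and Var (G n 0) / n tends to a constant above
  1. A single correlation between levels i and j is only bounded by a geometric factor in |i - j|;
  decay in i + j appears after averaging over the positions of the cells. Decay in i + j is what
  makes the double sum over levels bounded uniformly in n, and this uniformity matters: squared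
  covariances of order 1 on average give variances of order 1 / n^2 after normalisation, which are
  summable along the full sequence, so no subsequence and no interpolation in n is required.

  The choice of cos and cosh avoids joint densities. Both satisfy f x * f y = (f (x + y) + f (x -
  y)) / 2, and sums and differences of jointly Gaussian variables are Gaussian, so that only
  one-dimensional expectations enter.

  The function |v|^(2H) is concave on the half line for 2H <= 1 and convex for 2H > 1. The two
  regimes need separate arguments, and the exponent min H (1 - H) is their common outcome.\<close>

section \<open>Increments of the function |v|^p\<close>

text \<open>Dividing by the sum reduces the claim to t \<le> t powr p on the unit interval.\<close>

lemma powr_add_le_add_powr:
  fixes x y p :: real
  assumes "0 \<le> x" "0 \<le> y" "0 < p" "p \<le> 1"
  shows "(x + y) powr p \<le> x powr p + y powr p"
proof (cases "x + y = 0")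
  case False
  define s where "s = x + y"
  have s: "s > 0" using False assms by (simp add: s_def)
  have le: "t \<le> t powr p" if "0 \<le> t" "t \<le> 1" for t :: real
    using powr_mono'[of p 1 t] that assms by simp
  have "1 = x / s + y / s" using s by (simp add: s_def add_divide_distrib[symmetric])
  also have "\<dots> \<le> (x / s) powr p + (y / s) powr p"
    using assms s by (intro add_mono le) (auto simp: s_def)
  also have "\<dots> = (x powr p + y powr p) / s powr p"
    using assms s by (simp add: powr_divide add_divide_distrib)
  finally show ?thesis using s by (simp add: s_def field_simps)
qed (use assms in auto)

lemma abs_powr_diff_le:
  fixes x y p :: real
  assumes "0 < p" "p \<le> 1"
  shows "\<bar>\<bar>x\<bar> powr p - \<bar>y\<bar> powr p\<bar> \<le> \<bar>x - y\<bar> powr p"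
proof -
  have *: "\<bar>x\<bar> powr p \<le> \<bar>y\<bar> powr p + \<bar>x - y\<bar> powr p" for x y :: real
  proof -
    have "\<bar>x\<bar> powr p \<le> (\<bar>y\<bar> + \<bar>x - y\<bar>) powr p" using assms by (intro powr_mono2) auto
    also have "\<dots> \<le> \<bar>y\<bar> powr p + \<bar>x - y\<bar> powr p" using assms by (intro powr_add_le_add_powr) auto
    finally show ?thesis .
  qed
  show ?thesis using *[of x y] *[of y x] by (simp add: abs_minus_commute abs_le_iff)
qed

text \<open>For p = 2H this generates the covariances of W_H: the increments over [a, a + l] and
  [y, y + h] have covariance (g (y - a) - g (y - a - l)) / 2 with g =
  \<open>power_increment (2 * H) h\<close>.\<close>

definition power_increment :: "real \<Rightarrow> real \<Rightarrow> real \<Rightarrow> real" where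
  "power_increment p h v = \<bar>v + h\<bar> powr p - \<bar>v\<bar> powr p"

lemma power_increment_reflect: "power_increment p h (- h - v) = - power_increment p h v"
  unfolding power_increment_def by (simp add: abs_minus_commute)

text \<open>Concavity: the derivative of v powr p decreases for p \<le> 1. At x = 0 this derivative
  may blow up, and subadditivity takes its place.\<close>

lemma power_increment_antimono:
  assumes "0 < p" "p \<le> 1" "0 \<le> x" "x \<le> y" "0 \<le> h"
  shows "power_increment p h y \<le> power_increment p h x"
proof (cases "x = 0")
  case True
  then show ?thesis using abs_powr_diff_le[of p "y + h" y] assms
    by (simp add: power_increment_def)
next
  case False
  then have x: "x > 0" using assms by simp
  have "(y + h) powr p - y powr p \<le> (x + h) powr p - x powr p"
  proof (rule DERIV_nonpos_imp_nonincreasing[OF \<open>x \<le> y\<close>])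
    fix z assume z: "x \<le> z" "z \<le> y"
    have "((\<lambda>v. (v + h) powr p - v powr p) has_real_derivative
             p * (z + h) powr (p - 1) - p * z powr (p - 1)) (at z)"
      using z x assms by (auto intro!: derivative_eq_intros)
    moreover have "(z + h) powr (p - 1) \<le> z powr (p - 1)"
      using z x assms by (intro powr_mono2') auto
    ultimately show "\<exists>y. ((\<lambda>v. (v + h) powr p - v powr p) has_real_derivative y) (at z) \<and> y \<le> 0"
      using assms by (intro exI conjI) (auto simp: mult_left_mono)
  qed
  then show ?thesis using x assms by (simp add: power_increment_def)
qed

lemma power_increment_mono_straddling:
  assumes "0 < p" "- h \<le> x" "x \<le> y" "y \<le> 0"
  shows "power_increment p h x \<le> power_increment p h y"
  unfolding power_increment_def using assms
  by (intro diff_mono powr_mono2) auto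

lemma abs_power_increment_le:
  assumes "0 < p" "p \<le> 1" "0 \<le> h"
  shows "\<bar>power_increment p h v\<bar> \<le> h powr p"
  using abs_powr_diff_le[of p "v + h" v] assms by (simp add: power_increment_def)

text \<open>The odd power function; p times it, with r = p - 1, is the derivative of |x| powr
  p.\<close>

definition signed_powr :: "real \<Rightarrow> real \<Rightarrow> real" where
  "signed_powr r x = sgn x * \<bar>x\<bar> powr r"

lemma signed_powr_mono:
  assumes "0 < r" "x \<le> y"
  shows "signed_powr r x \<le> signed_powr r y"
proof -
  have eq: "signed_powr r z = (if 0 \<le> z then z powr r else - ((- z) powr r))" for z
    by (simp add: signed_powr_def sgn_if)
  consider "0 \<le> x" | "x < 0" "0 \<le> y" | "y < 0" using assms by linarith
  then show ?thesis
  proof cases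
    case 2
    have "- ((- x) powr r) \<le> y powr r"
      using powr_ge_zero[of "- x" r] powr_ge_zero[of y r] by linarith
    with 2 show ?thesis by (simp add: eq)
  qed (use assms in \<open>simp_all add: eq powr_mono2\<close>)
qed

text \<open>The factor 2 is for arguments of opposite sign, where each of the two powers is at most
  the power of the distance.\<close>

lemma signed_powr_holder:
  assumes "0 < r" "r \<le> 1"
  shows "\<bar>signed_powr r x - signed_powr r y\<bar> \<le> 2 * \<bar>x - y\<bar> powr r"
proof -
  have 1: "\<bar>\<bar>x\<bar> powr r - \<bar>y\<bar> powr r\<bar> \<le> \<bar>x - y\<bar> powr r" by (rule abs_powr_diff_le[OF assms])
  show ?thesis
  proof (cases "x * y \<ge> 0")
    case True
    then have "sgn x = sgn y \<or> x = 0 \<or> y = 0"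
      by (auto simp: sgn_if zero_le_mult_iff)
    then have "\<bar>signed_powr r x - signed_powr r y\<bar> \<le> \<bar>x - y\<bar> powr r"
      using 1 by (auto simp: signed_powr_def sgn_if split: if_splits)
    then show ?thesis by (smt (verit) powr_ge_zero)
  next
    case False
    then have "\<bar>x\<bar> powr r \<le> \<bar>x - y\<bar> powr r" "\<bar>y\<bar> powr r \<le> \<bar>x - y\<bar> powr r"
      using assms by (auto intro!: powr_mono2 simp: zero_le_mult_iff)
    moreover have "\<bar>signed_powr r z\<bar> \<le> \<bar>z\<bar> powr r" for z
      by (simp add: signed_powr_def sgn_if)
    ultimately show ?thesis by (smt (verit))
  qed
qed

lemma has_real_derivative_abs_powr:
  assumes "1 < p"
  shows "((\<lambda>x::real. \<bar>x\<bar> powr p) has_real_derivative p * signed_powr (p - 1) x) (at x)"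
proof (cases x "0::real" rule: linorder_cases)
  case greater
  have "((\<lambda>x::real. x powr p) has_real_derivative p * x powr (p - 1)) (at x)"
    using greater by (auto intro!: derivative_eq_intros)
  then have "((\<lambda>x::real. \<bar>x\<bar> powr p) has_real_derivative p * x powr (p - 1)) (at x)"
    by (rule has_field_derivative_transform_within_open[of _ _ _ "{0<..}"]) (use greater in auto)
  then show ?thesis using greater by (simp add: signed_powr_def)
next
  case less
  have "((\<lambda>x::real. (- x) powr p) has_real_derivative - (p * (- x) powr (p - 1))) (at x)"
    using less by (auto intro!: derivative_eq_intros)
  then have "((\<lambda>x::real. \<bar>x\<bar> powr p) has_real_derivative - (p * (- x) powr (p - 1))) (at x)"
    by (rule has_field_derivative_transform_within_open[of _ _ _ "{..<0}"]) (use less in auto)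
  then show ?thesis using less by (simp add: signed_powr_def)
next
  case equal
  have "((\<lambda>h. \<bar>h\<bar> powr (p - 1)) \<longlongrightarrow> 0) (at (0::real))"
    using assms by (intro tendsto_eq_intros) (auto intro!: tendsto_eq_intros)
  moreover have "\<bar>(\<bar>h\<bar> powr p) / h\<bar> \<le> \<bar>h\<bar> powr (p - 1)" for h :: real
    using assms by (cases "h = 0") (auto simp: powr_diff abs_mult)
  ultimately have "((\<lambda>h. (\<bar>h\<bar> powr p) / h) \<longlongrightarrow> 0) (at (0::real))"
    by (intro Lim_null_comparison[of "\<lambda>h. (\<bar>h\<bar> powr p) / h" "\<lambda>h. \<bar>h\<bar> powr (p - 1)"]) auto
  then show ?thesis using equal assms by (simp add: DERIV_def signed_powr_def)
qed

lemma has_real_derivative_power_increment: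
  assumes "1 < p"
  shows "(power_increment p h has_real_derivative
            p * (signed_powr (p - 1) (v + h) - signed_powr (p - 1) v)) (at v)"
proof -
  have "((\<lambda>v. \<bar>v + h\<bar> powr p) has_real_derivative p * signed_powr (p - 1) (v + h) * 1) (at v)"
    by (rule DERIV_chain2[OF has_real_derivative_abs_powr[OF assms]])
       (auto intro!: derivative_eq_intros)
  then have "((\<lambda>v. \<bar>v + h\<bar> powr p - \<bar>v\<bar> powr p) has_real_derivative
      p * signed_powr (p - 1) (v + h) * 1 - p * signed_powr (p - 1) v) (at v)"
    by (rule DERIV_diff) (rule has_real_derivative_abs_powr[OF assms])
  then show ?thesis unfolding power_increment_def by (simp add: algebra_simps)
qed

lemma power_increment_mono:
  assumes "1 < p" "0 \<le> h" "x \<le> y"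
  shows "power_increment p h x \<le> power_increment p h y"
proof (rule DERIV_nonneg_imp_nondecreasing[OF \<open>x \<le> y\<close>])
  fix v
  show "\<exists>D. (power_increment p h has_real_derivative D) (at v) \<and> 0 \<le> D"
    by (rule exI, rule conjI, rule has_real_derivative_power_increment)
       (use assms signed_powr_mono[of "p - 1" v "v + h"] in auto)
qed

text \<open>The exponents are placed symmetrically around p / 2, so that multiplication by (h
  l)^(-p/2) leaves the ratio (h / l)^\<gamma>. For p \<le> 1 the right side is 4 h^p and each term
  is bounded separately. For p > 1 it is 4 h l^(p-1), one factor h coming from the mean value
  theorem and l^(p-1) from the Holder continuity of the derivative.\<close>

lemma power_increment_gap:
  assumes "0 < p" "p < 2" "0 < h" "h \<le> l"
  defines "\<gamma> \<equiv> min (p / 2) (1 - p / 2)"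
  shows "\<bar>power_increment p h w - power_increment p h (w - l)\<bar>
           \<le> 4 * (h powr (p / 2 + \<gamma>) * l powr (p / 2 - \<gamma>))"
proof (cases "p \<le> 1")
  case True
  then have "h powr (p / 2 + \<gamma>) * l powr (p / 2 - \<gamma>) = h powr p"
    using assms(1-4) by (simp add: \<gamma>_def)
  then show ?thesis
    using abs_power_increment_le[of p h w] abs_power_increment_le[of p h "w - l"] assms(1-4) True
      powr_ge_zero[of h p] by auto
next
  case False
  then have \<gamma>: "\<gamma> = 1 - p / 2" and p: "1 < p" by (auto simp: \<gamma>_def)
  \<comment> \<open>The mixed second difference is symmetric in its two steps, so the mean value
    theorem can be applied along the short step h to increments of length l.\<close>
  have "\<exists>z. w < z \<and> z < w + h \<and> power_increment p l (w + h - l) - power_increment p l (w - l)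
      = h * (p * (signed_powr (p - 1) z - signed_powr (p - 1) (z - l)))"
  proof -
    have D: "((\<lambda>v. power_increment p l (v - l)) has_real_derivative
            p * (signed_powr (p - 1) v - signed_powr (p - 1) (v - l))) (at v)" for v
    proof -
      have "((\<lambda>v. v - l) has_real_derivative 1) (at v)" by (auto intro!: derivative_eq_intros)
      from DERIV_chain2[OF has_real_derivative_power_increment[OF p] this, of l]
      show ?thesis by simp
    qed
    obtain z where "w < z" "z < w + h"
      "power_increment p l (w + h - l) - power_increment p l (w - l)
         = (w + h - w) * (p * (signed_powr (p - 1) z - signed_powr (p - 1) (z - l)))"
      using MVT2[of w "w + h", OF _ D] \<open>0 < h\<close> by (metis less_add_same_cancel1)
    then show ?thesis by (intro exI[of _ z]) simp
  qed
  then obtain z where z: "power_increment p l (w + h - l) - power_increment p l (w - l)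
      = h * (p * (signed_powr (p - 1) z - signed_powr (p - 1) (z - l)))" by blast
  have "\<bar>power_increment p h w - power_increment p h (w - l)\<bar>
      = h * (p * \<bar>signed_powr (p - 1) z - signed_powr (p - 1) (z - l)\<bar>)"
  proof -
    have "power_increment p h w - power_increment p h (w - l)
      = power_increment p l (w + h - l) - power_increment p l (w - l)"
      unfolding power_increment_def by (simp add: algebra_simps)
    then show ?thesis using z \<open>0 < h\<close> \<open>0 < p\<close> by (simp add: abs_mult)
  qed
  also have "\<dots> \<le> h * (2 * (2 * \<bar>z - (z - l)\<bar> powr (p - 1)))"
    using signed_powr_holder[of "p - 1" z "z - l"] assms(1-4) p
    by (intro mult_left_mono mult_mono) auto
  also have "\<dots> = 4 * (h powr (p / 2 + \<gamma>) * l powr (p / 2 - \<gamma>))"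
    using assms(1-4) by (simp add: \<gamma>)
  finally show ?thesis .
qed

text \<open>\<open>T\<close> plays the role of the variation function: its increments dominate those
  of \<open>power_increment p h\<close>, so sums over ordered points telescope. The interval [-2, 2]
  contains all differences of grid points that occur later; 24 serves both regimes.\<close>

lemma power_increment_variation:
  assumes "0 < p" "p < 2" "0 < h" "h \<le> 1"
  obtains T where "\<And>x y. x \<le> y \<Longrightarrow> \<bar>power_increment p h y - power_increment p h x\<bar> \<le> T y - T x"
    "T 2 - T (- 2) \<le> 24 * h powr min p 1"
proof (cases "p \<le> 1")
  case True
  let ?g = "power_increment p h"
  \<comment> \<open>Jordan decomposition. The function rises on [-h, 0] and falls on the two outer
    half lines; \<open>P\<close> follows it on the middle piece, \<open>Q\<close> collects the outer
    pieces with the sign reversed, and clamping keeps each constant elsewhere.\<close>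
  define P where "P v = ?g (max (- h) (min v 0))" for v
  define Q where "Q v = - ?g (min v (- h)) - ?g (max v 0)" for v
  have P: "P x \<le> P y" if "x \<le> y" for x y
    unfolding P_def using assms that by (intro power_increment_mono_straddling) auto
  have neg: "?g y \<le> ?g x" if "0 \<le> x" "x \<le> y" for x y
    using assms True that by (intro power_increment_antimono) auto
  have neg': "?g (min y (- h)) \<le> ?g (min x (- h))" if "x \<le> y" for x y
    using neg[of "- h - min y (- h)" "- h - min x (- h)"] that
    by (simp add: power_increment_reflect)
  have Q: "Q x \<le> Q y" if "x \<le> y" for x y
    unfolding Q_def using neg'[OF that] neg[of "max x 0" "max y 0"] that by linarith
  have g: "?g v = P v - Q v - ?g (- h) - ?g 0" for v
  proof -
    consider "v \<le> - h" | "- h \<le> v" "v \<le> 0" | "0 \<le> v" by linarith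
    then show ?thesis using \<open>0 < h\<close> by cases (simp_all add: P_def Q_def)
  qed
  show ?thesis
  proof (rule that[of "\<lambda>v. P v + Q v"])
    show "\<bar>?g y - ?g x\<bar> \<le> P y + Q y - (P x + Q x)" if "x \<le> y" for x y
      using P[OF that] Q[OF that] g[of x] g[of y] by linarith
    have b: "\<bar>?g v\<bar> \<le> h powr p" for v
      using assms True by (intro abs_power_increment_le) auto
    have "P 2 + Q 2 - (P (- 2) + Q (- 2)) = ?g 0 - ?g (- h) - ?g 2 - (?g (- h) - ?g (- 2) - ?g 0)"
      using assms by (simp add: P_def Q_def)
    also have "\<dots> \<le> 6 * h powr p"
      using b[of 0] b[of "- h"] b[of 2] b[of "- 2"] unfolding abs_le_iff by linarith
    also have "\<dots> \<le> 24 * h powr min p 1" using True by simp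
    finally show "P 2 + Q 2 - (P (- 2) + Q (- 2)) \<le> 24 * h powr min p 1" .
  qed
next
  case False
  have "power_increment p h 2 - power_increment p h (- 2) \<le> 24 * h"
  proof -
    have B: "\<bar>power_increment p h v\<bar> \<le> 12 * h" if "\<bar>v\<bar> \<le> 2" for v
    proof -
      have D: "((\<lambda>x. \<bar>x\<bar> powr p) has_real_derivative p * signed_powr (p - 1) x) (at x)" for x
        using False by (intro has_real_derivative_abs_powr) simp
      obtain z where z: "v < z" "z < v + h"
          "\<bar>v + h\<bar> powr p - \<bar>v\<bar> powr p = (v + h - v) * (p * signed_powr (p - 1) z)"
        using MVT2[of v "v + h", OF _ D] \<open>0 < h\<close> by (metis less_add_same_cancel1)
      have "\<bar>z\<bar> powr (p - 1) \<le> 3 powr (p - 1)"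
        using z that assms False by (intro powr_mono2) auto
      also have "\<dots> \<le> 3 powr 1" using assms by (intro powr_mono) auto
      finally have "\<bar>signed_powr (p - 1) z\<bar> \<le> 3" by (auto simp: signed_powr_def sgn_if)
      then have "p * \<bar>signed_powr (p - 1) z\<bar> \<le> 2 * 3" using assms by (intro mult_mono) auto
      then have "h * (p * \<bar>signed_powr (p - 1) z\<bar>) \<le> h * 12" using assms by (intro mult_left_mono) auto
      then show ?thesis using z assms by (simp add: power_increment_def abs_mult)
    qed
    show ?thesis using B[of 2] B[of "-2"] by auto
  qed
  then show ?thesis
    using assms False by (intro that[of "power_increment p h"]) (auto simp: power_increment_mono)
qed

lemma sum_lessThan_mult:
  fixes f :: "nat \<Rightarrow> 'a::comm_monoid_add"
  shows "(\<Sum>s<n * m. f s) = (\<Sum>p<n. \<Sum>r<m. f (p * m + r))"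
proof -
  have "sum f {p * m..<p * m + m} = (\<Sum>r<m. f (p * m + r))" for p
    using sum.shift_bounds_nat_ivl[of f 0 "p * m" m] by (simp add: lessThan_atLeast0 add.commute)
  then show ?thesis by (simp flip: sum.nat_group)
qed

lemma sum_mod_power:
  fixes F :: "nat \<Rightarrow> real"
  assumes "j \<le> n"
  shows "(\<Sum>k<b ^ n. F (k mod b ^ j)) = real b ^ (n - j) * (\<Sum>s<b ^ j. F s)"
proof -
  have "b ^ n = b ^ (n - j) * b ^ j" using assms by (simp flip: power_add)
  then have "(\<Sum>k<b ^ n. F (k mod b ^ j)) = (\<Sum>p<b ^ (n - j). \<Sum>r<b ^ j. F ((p * b ^ j + r) mod b ^ j))"
    by (simp add: sum_lessThan_mult)
  also have "\<dots> = (\<Sum>p<b ^ (n - j). \<Sum>r<b ^ j. F r)" by (intro sum.cong refl) simp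
  finally show ?thesis by simp
qed

section \<open>Correlations of increments over b-adic cells\<close>

locale badic_grid =
  fixes H :: real and b :: nat
  assumes H_pos: "0 < H" and H_less: "H < 1" and b_ge: "2 \<le> b"
begin

definition mesh :: "nat \<Rightarrow> real" where "mesh i = 1 / real b ^ i"

text \<open>The factor by which the bound on the correlation of two cells shrinks with each level
  that separates them; it is less than 1 for every H in (0,1).\<close>

definition rate :: real where "rate = real b powr (- min H (1 - H))"

text \<open>The correlation of the increments of W_H over cell r of level i and cell s of level j,
  given as a closed formula so that all estimates are free of probability;
  \<open>expectation_cell_increment_mult\<close> makes the connection.\<close>

definition cell_cov :: "nat \<Rightarrow> nat \<Rightarrow> nat \<Rightarrow> nat \<Rightarrow> real" where
  "cell_cov i r j s = (mesh i * mesh j) powr (- H) *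
     (power_increment (2 * H) (mesh j) (real s * mesh j - real r * mesh i)
      - power_increment (2 * H) (mesh j) (real s * mesh j - real r * mesh i - mesh i)) / 2"

lemma mesh_pos: "0 < mesh i" and mesh_le_1: "mesh i \<le> 1"
  using b_ge by (auto simp: mesh_def intro: one_le_power)

lemma mesh_powr: "mesh i powr x = real b powr (- real i * x)"
  using b_ge by (simp add: mesh_def powr_divide powr_powr flip: powr_realpow powr_minus_divide)

lemma rate_bounds: "0 < rate" "rate < 1"
  using b_ge H_pos H_less by (auto simp: rate_def powr_less_one)

lemma rate_power: "rate ^ n = mesh n powr min H (1 - H)"
  using b_ge by (simp add: rate_def mesh_powr powr_powr mult.commute flip: powr_realpow)

lemma mesh_diff: "i \<le> j \<Longrightarrow> mesh j / mesh i = mesh (j - i)"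
  using b_ge by (simp add: mesh_def power_diff)

lemma mesh_mult_power: "real b ^ i * mesh i = 1"
  using b_ge by (simp add: mesh_def)

text \<open>The same second difference with the two steps exchanged. In this form a change of s by
  one moves the argument by exactly \<open>mesh j\<close>, as telescoping in s requires.\<close>

lemma cell_cov_eq:
  "cell_cov i r j s = (mesh i * mesh j) powr (- H) *
     (power_increment (2 * H) (mesh i) (real s * mesh j - real r * mesh i - mesh i + mesh j)
      - power_increment (2 * H) (mesh i) (real s * mesh j - real r * mesh i - mesh i)) / 2"
  unfolding cell_cov_def power_increment_def by (simp add: algebra_simps)

lemma cell_cov_sym: "cell_cov i r j s = cell_cov j s i r"
  unfolding cell_cov_def power_increment_def
  by (simp add: abs_minus_commute algebra_simps)

lemma cell_cov_self: "cell_cov i r i r = 1"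
  using mesh_pos[of i]
  by (simp add: cell_cov_def power_increment_def powr_mult powr_minus flip: powr_add)

lemma abs_cell_cov_le_aux:
  assumes "i \<le> j"
  shows "\<bar>cell_cov i r j s\<bar> \<le> 2 * rate ^ (j - i)"
proof -
  define \<gamma> where "\<gamma> = min H (1 - H)"
  have le: "mesh j \<le> mesh i" using assms b_ge by (simp add: mesh_def frac_le power_increasing)
  let ?w = "real s * mesh j - real r * mesh i"
  have gap: "\<bar>power_increment (2 * H) (mesh j) ?w - power_increment (2 * H) (mesh j) (?w - mesh i)\<bar>
      \<le> 4 * (mesh j powr (H + \<gamma>) * mesh i powr (H - \<gamma>))"
    using power_increment_gap[of "2 * H" "mesh j" "mesh i" ?w] H_pos H_less mesh_pos le
    by (simp add: \<gamma>_def)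
  have "\<bar>cell_cov i r j s\<bar> = (mesh i * mesh j) powr (- H) *
      \<bar>power_increment (2 * H) (mesh j) ?w - power_increment (2 * H) (mesh j) (?w - mesh i)\<bar> / 2"
    by (simp add: cell_cov_def abs_mult)
  also have "\<dots> \<le> (mesh i * mesh j) powr (- H) * (4 * (mesh j powr (H + \<gamma>) * mesh i powr (H - \<gamma>))) / 2"
    by (intro divide_right_mono mult_left_mono gap) auto
  also have "\<dots> = 2 * ((mesh i powr (- H) * mesh i powr (H - \<gamma>)) * (mesh j powr (- H) * mesh j powr (H + \<gamma>)))"
    using mesh_pos[of i] mesh_pos[of j] by (simp add: powr_mult)
  also have "\<dots> = 2 * (mesh j powr \<gamma> / mesh i powr \<gamma>)"
    by (simp only: powr_add[symmetric]) (simp add: powr_minus_divide)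
  also have "\<dots> = 2 * rate ^ (j - i)"
    using assms mesh_pos[of i] mesh_pos[of j]
    by (simp add: rate_power \<gamma>_def mesh_diff flip: powr_divide)
  finally show ?thesis .
qed

text \<open>With truncated subtraction of natural numbers, (j - i) + (i - j) is the distance of the
  two levels.\<close>

lemma abs_cell_cov_le: "\<bar>cell_cov i r j s\<bar> \<le> 2 * rate ^ ((j - i) + (i - j))"
proof (cases "i \<le> j")
  case False
  then show ?thesis using abs_cell_cov_le_aux[of j i s r] by (simp add: cell_cov_sym[of i])
qed (use abs_cell_cov_le_aux[of i j r s] in simp)

text \<open>b^(jH) = b^j * b^(-j(1-H)), and 1 - H is at least min H (1 - H). A sum over the b^j
  cells of level j is thus small compared with their number.\<close>

lemma mesh_powr_rate: "mesh j powr (- H) \<le> real b ^ j * rate ^ j"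
proof -
  have "mesh j powr (- H) = real b ^ j * mesh j powr (1 - H)"
    using b_ge by (simp add: mesh_powr algebra_simps flip: powr_realpow powr_add)
  also have "\<dots> \<le> real b ^ j * mesh j powr min H (1 - H)"
    using b_ge mesh_pos[of j] mesh_le_1[of j] by (intro mult_left_mono powr_mono') auto
  finally show ?thesis by (simp add: rate_power)
qed

text \<open>With the coarse cell fixed, consecutive fine cells give adjacent arguments, so the sum
  is at most the variation of the increment function with step \<open>mesh i\<close>. The remaining
  power of \<open>mesh i\<close> has the nonnegative exponent min (2H) 1 - H and is at most
  1.\<close>

lemma sum_abs_cell_cov_le:
  assumes "i \<le> j" "r < b ^ i"
  shows "(\<Sum>s<b ^ j. \<bar>cell_cov i r j s\<bar>) \<le> 24 * (real b ^ j * rate ^ j)"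
proof -
  define v where "v s = real s * mesh j - real r * mesh i - mesh i" for s :: nat
  obtain T where T: "\<And>x y. x \<le> y \<Longrightarrow> \<bar>power_increment (2 * H) (mesh i) y - power_increment (2 * H) (mesh i) x\<bar> \<le> T y - T x"
    and T2: "T 2 - T (- 2) \<le> 24 * mesh i powr min (2 * H) 1"
    using power_increment_variation[of "2 * H" "mesh i"] H_pos H_less mesh_pos mesh_le_1 by auto
  have mono: "T x \<le> T y" if "x \<le> y" for x y using T[OF that] by linarith
  have "real r * mesh i + mesh i = real (Suc r) * mesh i" by (simp add: algebra_simps)
  also have "\<dots> \<le> real (b ^ i) * mesh i"
    using assms mesh_pos[of i] by (intro mult_right_mono of_nat_mono) auto
  finally have a: "real r * mesh i + mesh i \<le> 1" by (simp add: mesh_mult_power)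
  have "0 \<le> real r * mesh i" "0 < mesh i" using mesh_pos[of i] by auto
  with a have v0: "- 2 \<le> v 0" and v1: "v (b ^ j) \<le> 2" using mesh_mult_power[of j]
    unfolding v_def of_nat_power by linarith+
  have "(\<Sum>s<b ^ j. \<bar>cell_cov i r j s\<bar>) \<le>
      (\<Sum>s<b ^ j. (mesh i * mesh j) powr (- H) / 2 * (T (v (Suc s)) - T (v s)))"
  proof (intro sum_mono)
    fix s
    have vS: "v (Suc s) = v s + mesh j" by (simp add: v_def algebra_simps)
    have "\<bar>cell_cov i r j s\<bar> = (mesh i * mesh j) powr (- H) / 2 *
        \<bar>power_increment (2 * H) (mesh i) (v (Suc s)) - power_increment (2 * H) (mesh i) (v s)\<bar>"
      unfolding cell_cov_eq vS by (simp add: v_def abs_mult)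
    also have "\<dots> \<le> (mesh i * mesh j) powr (- H) / 2 * (T (v (Suc s)) - T (v s))"
      using T[of "v s" "v (Suc s)"] mesh_pos[of j] vS by (intro mult_left_mono) auto
    finally show "\<bar>cell_cov i r j s\<bar> \<le> (mesh i * mesh j) powr (- H) / 2 * (T (v (Suc s)) - T (v s))" .
  qed
  also have "\<dots> = (mesh i * mesh j) powr (- H) / 2 * (T (v (b ^ j)) - T (v 0))"
    using sum_lessThan_telescope[of "\<lambda>s. T (v s)" "b ^ j"] by (simp only: sum_distrib_left[symmetric])
  also have "\<dots> \<le> (mesh i * mesh j) powr (- H) / 2 * (24 * mesh i powr min (2 * H) 1)"
    using T2 mono[OF v0] mono[OF v1] by (intro mult_left_mono) auto
  also have "\<dots> = 12 * (mesh i powr (min (2 * H) 1 - H) * mesh j powr (- H))"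
    using mesh_pos[of i] mesh_pos[of j] by (simp add: powr_mult powr_diff powr_minus field_simps)
  also have "\<dots> \<le> 12 * (1 * mesh j powr (- H))"
    using mesh_pos[of i] mesh_le_1[of i] H_pos H_less
    by (intro mult_left_mono mult_right_mono powr_le1) auto
  also have "\<dots> \<le> 24 * (real b ^ j * rate ^ j)" using mesh_powr_rate[of j] powr_ge_zero[of "mesh j" "- H"] by linarith
  finally show ?thesis .
qed

text \<open>For fixed leading digits of \<open>s\<close>, consecutive values of \<open>s mod b ^ i\<close> move the coarse cell
  away from the fine one in steps of \<open>mesh i - mesh j\<close>, so the increments telescope.\<close>

lemma sum_abs_cell_cov_diag_le:
  assumes "i < j"
  shows "(\<Sum>s<b ^ j. \<bar>cell_cov i (s mod b ^ i) j s\<bar>) \<le> 24 * (real b ^ j * rate ^ j)"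
proof -
  let ?g = "power_increment (2 * H) (mesh j)"
  obtain T where T: "\<And>x y. x \<le> y \<Longrightarrow> \<bar>?g y - ?g x\<bar> \<le> T y - T x"
    and T2: "T 2 - T (- 2) \<le> 24 * mesh j powr min (2 * H) 1"
    using power_increment_variation[of "2 * H" "mesh j"] H_pos H_less mesh_pos mesh_le_1 by auto
  have mono: "T x \<le> T y" if "x \<le> y" for x y using T[OF that] by linarith
  \<comment> \<open>Since b \<ge> 2, two steps of length \<open>mesh i - mesh j\<close> cover a
    window of length \<open>mesh i\<close>. Each term is therefore bounded by two consecutive
    increments of \<open>T\<close>, which gives two telescoping sums and the constant 48.\<close>
  have two: "2 * mesh j \<le> mesh i"
  proof -
    have "real b ^ Suc i \<le> real b ^ j" using assms b_ge by (intro power_increasing) auto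
    moreover have "2 * real b ^ i \<le> real b * real b ^ i" using b_ge by (intro mult_right_mono) auto
    ultimately have "2 * real b ^ i \<le> real b ^ j" by simp
    then show ?thesis using b_ge by (simp add: mesh_def field_simps)
  qed
  define C where "C = (mesh i * mesh j) powr (- H) / 2"
  have C: "0 \<le> C" by (simp add: C_def)
  have jsplit: "b ^ j = b ^ (j - i) * b ^ i" using assms by (simp flip: power_add)
  have inner: "(\<Sum>r<b ^ i. \<bar>cell_cov i r j (p * b ^ i + r)\<bar>) \<le> C * (48 * mesh j powr min (2 * H) 1)"
    if p: "p < b ^ (j - i)" for p
  proof -
    define w where "w r = real (p * b ^ i) * mesh j - real r * (mesh i - mesh j)" for r :: nat
    have wS: "w (Suc r) = w r - (mesh i - mesh j)" for r by (simp add: w_def algebra_simps)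
    have "real (p * b ^ i) \<le> real (b ^ j)" unfolding jsplit of_nat_le_iff using p by (intro mult_right_mono) auto
    then have "real (p * b ^ i) * mesh j \<le> 1"
      using mesh_mult_power[of j] mesh_pos[of j]
      by (metis less_eq_real_def mult_right_mono of_nat_power)
    then have w0: "w 0 \<le> 2" by (simp add: w_def)
    have w1: "w 1 \<le> 2" using w0 wS[of 0] two mesh_pos[of j] by simp
    have wend: "- 2 \<le> w (Suc (b ^ i))"
    proof -
      have "real (Suc (b ^ i)) * (mesh i - mesh j) \<le> real (Suc (b ^ i)) * mesh i"
        using mesh_pos[of j] by (intro mult_left_mono) auto
      also have "\<dots> \<le> 2" using mesh_mult_power[of i] mesh_le_1[of i] by (simp add: algebra_simps)
      moreover have "0 \<le> real (p * b ^ i) * mesh j" using mesh_pos[of j] by simp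
      ultimately show ?thesis unfolding w_def by linarith
    qed
    have wend': "- 2 \<le> w (b ^ i)" using wend wS[of "b ^ i"] two mesh_pos[of j] by simp
    have "(\<Sum>r<b ^ i. \<bar>cell_cov i r j (p * b ^ i + r)\<bar>)
        \<le> (\<Sum>r<b ^ i. C * ((T (w r) - T (w (Suc r))) + (T (w (Suc r)) - T (w (Suc (Suc r))))))"
    proof (intro sum_mono)
      fix r
      have "real (p * b ^ i + r) * mesh j - real r * mesh i = w r" by (simp add: w_def algebra_simps)
      then have "\<bar>cell_cov i r j (p * b ^ i + r)\<bar> = C * \<bar>?g (w r) - ?g (w r - mesh i)\<bar>"
        unfolding cell_cov_def by (simp add: C_def abs_mult)
      also have "\<dots> \<le> C * (T (w r) - T (w r - mesh i))"
        using T[of "w r - mesh i" "w r"] mesh_pos[of i] C by (intro mult_left_mono) auto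
      also have "\<dots> \<le> C * (T (w r) - T (w (Suc (Suc r))))"
        using C two wS[of r] wS[of "Suc r"] by (intro mult_left_mono diff_left_mono mono) auto
      finally show "\<bar>cell_cov i r j (p * b ^ i + r)\<bar> \<le>
          C * ((T (w r) - T (w (Suc r))) + (T (w (Suc r)) - T (w (Suc (Suc r)))))" by simp
    qed
    also have "\<dots> = C * ((T (w 0) - T (w (b ^ i))) + (T (w 1) - T (w (Suc (b ^ i)))))"
      using sum_lessThan_telescope'[of "\<lambda>r. T (w r)" "b ^ i"] sum_lessThan_telescope'[of "\<lambda>r. T (w (Suc r))" "b ^ i"]
      by (simp only: sum_distrib_left[symmetric] sum.distrib One_nat_def)
    also have "\<dots> \<le> C * (48 * mesh j powr min (2 * H) 1)"
      using T2 mono[OF w0] mono[OF w1] mono[OF wend] mono[OF wend'] C by (intro mult_left_mono) linarith+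
    finally show ?thesis .
  qed
  have "(\<Sum>s<b ^ j. \<bar>cell_cov i (s mod b ^ i) j s\<bar>)
      = (\<Sum>p<b ^ (j - i). \<Sum>r<b ^ i. \<bar>cell_cov i r j (p * b ^ i + r)\<bar>)"
    unfolding jsplit sum_lessThan_mult by (intro sum.cong refl) simp
  also have "\<dots> \<le> (\<Sum>p<b ^ (j - i). C * (48 * mesh j powr min (2 * H) 1))"
    using inner by (intro sum_mono) auto
  also have "\<dots> = 24 * (real b ^ (j - i) * (mesh i powr (- H) * (mesh j powr (- H) * mesh j powr min (2 * H) 1)))"
    using mesh_pos[of i] mesh_pos[of j] by (simp add: C_def powr_mult)
  \<comment> \<open>Here min (2H) 1 - H = min H (1 - H), the exponent in
    \<open>rate\<close>.\<close>
  also have "mesh j powr (- H) * mesh j powr min (2 * H) 1 = rate ^ j"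
    unfolding rate_power powr_add[symmetric] by (rule arg_cong[of _ _ "\<lambda>x. mesh j powr x"]) auto
  also have "24 * (real b ^ (j - i) * (mesh i powr (- H) * rate ^ j)) \<le> 24 * (real b ^ (j - i) * (real b ^ i * rate ^ j))"
  proof -
    have "rate ^ i \<le> 1" using rate_bounds by (intro power_le_one) auto
    then have "mesh i powr (- H) \<le> real b ^ i * 1"
      using mesh_powr_rate[of i] by (intro order.trans[OF mesh_powr_rate] mult_left_mono) auto
    then show ?thesis using rate_bounds by (intro mult_left_mono mult_right_mono) auto
  qed
  also have "\<dots> = 24 * (real b ^ j * rate ^ j)" using assms by (simp flip: power_add mult.assoc)
  finally show ?thesis .
qed

end

section \<open>Averages of covariances over all cell indices\<close>

lemma sum_power_le_geometric:
  fixes x :: real and f :: "'b \<Rightarrow> nat"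
  assumes "0 \<le> x" "x < 1" "inj_on f A" "finite A"
  shows "(\<Sum>a\<in>A. x ^ f a) \<le> 1 / (1 - x)"
proof -
  have "(\<Sum>a\<in>A. x ^ f a) = (\<Sum>k\<in>f ` A. x ^ k)" using assms by (simp add: sum.reindex)
  also have "\<dots> \<le> (\<Sum>k. x ^ k)" using assms by (intro sum_le_suminf summable_geometric) auto
  also have "\<dots> = 1 / (1 - x)" using assms by (intro suminf_geometric) auto
  finally show ?thesis .
qed

context badic_grid
begin

text \<open>The covariance of the Gaussian sums over levels 1 to n with indices k and l, before
  division by n.\<close>

definition path_cov :: "nat \<Rightarrow> nat \<Rightarrow> nat \<Rightarrow> real" where
  "path_cov n k l = (\<Sum>i\<in>{1..n}. \<Sum>j\<in>{1..n}. cell_cov i (k mod b ^ i) j (l mod b ^ j))"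

lemma sum_rate_dist_le: "(\<Sum>j\<in>{1..n}. rate ^ ((j - i) + (i - j))) \<le> 2 / (1 - rate)"
proof -
  let ?A = "{1..n} \<inter> {i..}" and ?B = "{1..n} \<inter> {..i}"
  let ?f = "\<lambda>j. rate ^ ((j - i) + (i - j))"
  have "{1..n} = ?A \<union> ?B" by auto
  then have "sum ?f {1..n} = sum ?f (?A \<union> ?B)" by (rule arg_cong)
  also have "\<dots> \<le> sum ?f (?A \<union> ?B) + sum ?f (?A \<inter> ?B)"
    using rate_bounds by (simp add: sum_nonneg)
  also have "\<dots> = sum ?f ?A + sum ?f ?B" by (rule sum.union_inter) auto
  also have "\<dots> \<le> 1 / (1 - rate) + 1 / (1 - rate)"
    using rate_bounds by (intro add_mono sum_power_le_geometric) (auto simp: inj_on_def)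
  finally show ?thesis by simp
qed

text \<open>Row sums of the geometric bound do not depend on n. This crude estimate holds for every
  k and l and later keeps the exponentials of the normalised covariances bounded.\<close>

lemma abs_path_cov_le: "\<bar>path_cov n k l\<bar> \<le> 4 / (1 - rate) * real n"
proof -
  have "\<bar>path_cov n k l\<bar> \<le> (\<Sum>i\<in>{1..n}. \<Sum>j\<in>{1..n}. 2 * rate ^ ((j - i) + (i - j)))"
    unfolding path_cov_def
    by (intro order.trans[OF sum_abs] sum_mono abs_cell_cov_le)
  also have "\<dots> \<le> (\<Sum>i\<in>{1..n}. 2 * (2 / (1 - rate)))"
    unfolding sum_distrib_left[symmetric] by (intro sum_mono mult_left_mono sum_rate_dist_le) auto
  finally show ?thesis by (simp add: mult.commute)
qed

text \<open>The eighth root is chosen to budget exponents: for i \<le> j, \<open>rate ^ j\<close> is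
  at most \<open>root_rate ^ (4 * (i + j))\<close>. The weights in the Cauchy-Schwarz step below use
  up 2 (i + j) of this exponent, and the other half is still summable over both levels.\<close>

definition root_rate :: real where "root_rate = rate powr (1 / 8)"

lemma root_rate_bounds: "0 < root_rate" "root_rate < 1"
  using rate_bounds powr_less_mono2[of "1 / 8" rate 1] by (auto simp: root_rate_def)

lemma rate_power_le: "i \<le> j \<Longrightarrow> rate ^ j \<le> root_rate ^ (4 * (i + j))"
proof -
  assume ij: "i \<le> j"
  have "root_rate ^ 8 = rate" using rate_bounds by (simp add: root_rate_def powr_power)
  then have "rate ^ j = root_rate ^ (8 * j)" by (simp add: power_mult)
  also have "\<dots> \<le> root_rate ^ (4 * (i + j))"
    using ij root_rate_bounds by (intro power_decreasing) auto
  finally show ?thesis .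
qed

text \<open>For i < j the residue modulo b^j determines the one modulo b^i, and each residue modulo
  b^j occurs b^(n-j) times. So only the sum over the finer level is involved, with the coarse cell
  moving along.\<close>

lemma sum_diag_cell_cov_le:
  assumes "i \<noteq> j" "i \<le> n" "j \<le> n"
  shows "(\<Sum>k<b ^ n. \<bar>cell_cov i (k mod b ^ i) j (k mod b ^ j)\<bar>) \<le> 24 * real b ^ n * root_rate ^ (4 * (i + j))"
proof -
  have *: "(\<Sum>k<b ^ n. \<bar>cell_cov i (k mod b ^ i) j (k mod b ^ j)\<bar>) \<le> 24 * real b ^ n * root_rate ^ (4 * (i + j))"
    if ij: "i < j" "j \<le> n" for i j
  proof -
    have "k mod b ^ i = (k mod b ^ j) mod b ^ i" for k
      using ij by (simp add: le_imp_power_dvd mod_mod_cancel)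
    then have "(\<Sum>k<b ^ n. \<bar>cell_cov i (k mod b ^ i) j (k mod b ^ j)\<bar>)
        = (\<Sum>k<b ^ n. (\<lambda>s. \<bar>cell_cov i (s mod b ^ i) j s\<bar>) (k mod b ^ j))" by simp
    also have "\<dots> = real b ^ (n - j) * (\<Sum>s<b ^ j. \<bar>cell_cov i (s mod b ^ i) j s\<bar>)"
      using ij by (intro sum_mod_power) simp
    also have "\<dots> \<le> real b ^ (n - j) * (24 * (real b ^ j * root_rate ^ (4 * (i + j))))"
      using ij b_ge
      by (intro mult_left_mono order.trans[OF sum_abs_cell_cov_diag_le] rate_power_le) auto
    also have "\<dots> = 24 * real b ^ n * root_rate ^ (4 * (i + j))"
      using ij by (simp flip: power_add mult.assoc)
    finally show ?thesis .
  qed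
  show ?thesis
  proof (cases "i < j")
    case False
    then show ?thesis using *[of j i] assms by (simp add: cell_cov_sym[of i _ j] add.commute)
  qed (use *[of i j] assms in auto)
qed

text \<open>Here the two indices vary independently: the coarser cell is held fixed while the finer
  one runs, and the bound is uniform in the fixed cell.\<close>

lemma sum_indep_cell_cov_le:
  assumes "i \<le> n" "j \<le> n"
  shows "(\<Sum>k<b ^ n. \<Sum>l<b ^ n. \<bar>cell_cov i (k mod b ^ i) j (l mod b ^ j)\<bar>)
           \<le> 24 * (real b ^ n)\<^sup>2 * root_rate ^ (4 * (i + j))"
proof -
  have *: "(\<Sum>k<b ^ n. \<Sum>l<b ^ n. \<bar>cell_cov i (k mod b ^ i) j (l mod b ^ j)\<bar>)
           \<le> 24 * (real b ^ n)\<^sup>2 * root_rate ^ (4 * (i + j))" if ij: "i \<le> j" "j \<le> n" for i j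
  proof -
    have "(\<Sum>l<b ^ n. \<bar>cell_cov i (k mod b ^ i) j (l mod b ^ j)\<bar>)
        \<le> 24 * real b ^ n * root_rate ^ (4 * (i + j))" for k
    proof -
      have "(\<Sum>l<b ^ n. \<bar>cell_cov i (k mod b ^ i) j (l mod b ^ j)\<bar>)
          = real b ^ (n - j) * (\<Sum>s<b ^ j. \<bar>cell_cov i (k mod b ^ i) j s\<bar>)"
        using ij by (intro sum_mod_power[of j n "\<lambda>s. \<bar>cell_cov i (k mod b ^ i) j s\<bar>"]) simp
      also have "\<dots> \<le> real b ^ (n - j) * (24 * (real b ^ j * root_rate ^ (4 * (i + j))))"
        using ij b_ge
        by (intro mult_left_mono order.trans[OF sum_abs_cell_cov_le] rate_power_le) auto
      also have "\<dots> = 24 * real b ^ n * root_rate ^ (4 * (i + j))"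
        using ij by (simp flip: power_add mult.assoc)
      finally show ?thesis .
    qed
    then have "(\<Sum>k<b ^ n. \<Sum>l<b ^ n. \<bar>cell_cov i (k mod b ^ i) j (l mod b ^ j)\<bar>)
        \<le> (\<Sum>k<b ^ n. 24 * real b ^ n * root_rate ^ (4 * (i + j)))"
      by (intro sum_mono)
    then show ?thesis by (simp add: power2_eq_square)
  qed
  show ?thesis
  proof (cases "i \<le> j")
    case False
    have "(\<Sum>k<b ^ n. \<Sum>l<b ^ n. \<bar>cell_cov i (k mod b ^ i) j (l mod b ^ j)\<bar>)
      = (\<Sum>l<b ^ n. \<Sum>k<b ^ n. \<bar>cell_cov j (l mod b ^ j) i (k mod b ^ i)\<bar>)"
      by (subst sum.swap) (simp add: cell_cov_sym[of i _ j])
    then show ?thesis using *[of j i] assms False by (simp add: add.commute)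
  qed (use *[of i j] assms in auto)
qed

lemma sum_root_rate_le: "(\<Sum>i\<in>{1..n}. \<Sum>j\<in>{1..n}. root_rate ^ (i + j)) \<le> (1 / (1 - root_rate))\<^sup>2"
proof -
  have "(\<Sum>i\<in>{1..n}. \<Sum>j\<in>{1..n}. root_rate ^ (i + j)) = (\<Sum>i\<in>{1..n}. root_rate ^ i)\<^sup>2"
    by (simp add: power_add power2_eq_square sum_product)
  also have "\<dots> \<le> (1 / (1 - root_rate))\<^sup>2"
    using root_rate_bounds by (intro power_mono sum_power_le_geometric sum_nonneg) auto
  finally show ?thesis .
qed

lemma sum_root_rate_mult_le:
  assumes "1 \<le> m"
  shows "(\<Sum>i\<in>{1..n}. \<Sum>j\<in>{1..n}. root_rate ^ (m * (i + j))) \<le> (1 / (1 - root_rate))\<^sup>2"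
  using root_rate_bounds assms
  by (intro order.trans[OF _ sum_root_rate_le[of n]] sum_mono power_decreasing) auto

text \<open>The terms with i = j are correlations of a cell with itself and contribute exactly n.
  The others have averages that are summable over both levels.\<close>

lemma sum_abs_path_cov_diag_le:
  "(\<Sum>k<b ^ n. \<bar>path_cov n k k - real n\<bar>) \<le> 24 * (1 / (1 - root_rate))\<^sup>2 * real b ^ n"
proof -
  let ?c = "\<lambda>i j k. cell_cov i (k mod b ^ i) j (k mod b ^ j)"
  let ?d = "\<lambda>i j k. if i = j then 0 else \<bar>?c i j k\<bar>"
  have "\<bar>path_cov n k k - real n\<bar> \<le> (\<Sum>i\<in>{1..n}. \<Sum>j\<in>{1..n}. ?d i j k)" for k
  proof -
    have "(\<Sum>i\<in>{1..n}. \<Sum>j\<in>{1..n}. if i = j then 1 else 0) = real n" by simp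
    then have "path_cov n k k - real n
        = (\<Sum>i\<in>{1..n}. \<Sum>j\<in>{1..n}. ?c i j k - (if i = j then 1 else 0))"
      unfolding path_cov_def sum_subtractf by simp
    also have "\<dots> = (\<Sum>i\<in>{1..n}. \<Sum>j\<in>{1..n}. if i = j then 0 else ?c i j k)"
      by (intro sum.cong refl) (auto simp: cell_cov_self)
    finally have "path_cov n k k - real n = (\<Sum>i\<in>{1..n}. \<Sum>j\<in>{1..n}. if i = j then 0 else ?c i j k)" .
    then have "\<bar>path_cov n k k - real n\<bar> = \<bar>\<Sum>i\<in>{1..n}. \<Sum>j\<in>{1..n}. if i = j then 0 else ?c i j k\<bar>"
      by (rule arg_cong)
    also have "\<dots> \<le> (\<Sum>i\<in>{1..n}. \<Sum>j\<in>{1..n}. \<bar>if i = j then 0 else ?c i j k\<bar>)"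
      by (intro order.trans[OF sum_abs] sum_mono order.refl)
    also have "\<dots> = (\<Sum>i\<in>{1..n}. \<Sum>j\<in>{1..n}. ?d i j k)" by (intro sum.cong refl) auto
    finally show ?thesis .
  qed
  then have "(\<Sum>k<b ^ n. \<bar>path_cov n k k - real n\<bar>) \<le> (\<Sum>k<b ^ n. \<Sum>i\<in>{1..n}. \<Sum>j\<in>{1..n}. ?d i j k)"
    by (intro sum_mono)
  also have "\<dots> = (\<Sum>i\<in>{1..n}. \<Sum>k<b ^ n. \<Sum>j\<in>{1..n}. ?d i j k)" by (rule sum.swap)
  also have "\<dots> = (\<Sum>i\<in>{1..n}. \<Sum>j\<in>{1..n}. \<Sum>k<b ^ n. ?d i j k)"
    by (rule sum.cong[OF refl], rule sum.swap)
  also have "\<dots> \<le> (\<Sum>i\<in>{1..n}. \<Sum>j\<in>{1..n}. 24 * real b ^ n * root_rate ^ (4 * (i + j)))"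
  proof (intro sum_mono)
    fix i j assume "i \<in> {1..n}" "j \<in> {1..n}"
    then show "(\<Sum>k<b ^ n. ?d i j k) \<le> 24 * real b ^ n * root_rate ^ (4 * (i + j))"
      using sum_diag_cell_cov_le[of i j n] root_rate_bounds by (cases "i = j") auto
  qed
  also have "\<dots> \<le> 24 * real b ^ n * (1 / (1 - root_rate))\<^sup>2"
    unfolding sum_distrib_left[symmetric] by (intro mult_left_mono sum_root_rate_mult_le) auto
  finally show ?thesis by (simp only: mult_ac)
qed

text \<open>Cauchy-Schwarz with the weights \<open>root_rate ^ (i + j)\<close> moves the square
  inside the double sum over levels at the cost of a constant, where uniform weights would cost n^2.
  Correlations are at most 2 by the bound at hand, so their squares are at most twice their absolute
  values; hence 48 = 2 * 24.\<close>

lemma sum_path_cov_square_le: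
  "(\<Sum>k<b ^ n. \<Sum>l<b ^ n. (path_cov n k l)\<^sup>2) \<le> 48 * (1 / (1 - root_rate)) ^ 4 * (real b ^ n)\<^sup>2"
proof -
  let ?c = "\<lambda>i j k l. cell_cov i (k mod b ^ i) j (l mod b ^ j)"
  let ?I = "{1..n} \<times> {1..n}"
  let ?K = "(1 / (1 - root_rate))\<^sup>2"
  have sq: "(root_rate ^ m)\<^sup>2 = root_rate ^ (2 * m)" for m
    by (metis power_mult mult.commute)
  have "(path_cov n k l)\<^sup>2 \<le> ?K * (\<Sum>(i, j)\<in>?I. 2 * \<bar>?c i j k l\<bar> / root_rate ^ (2 * (i + j)))" for k l
  proof -
    have "path_cov n k l = (\<Sum>(i, j)\<in>?I. root_rate ^ (i + j) * (?c i j k l / root_rate ^ (i + j)))"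
      using root_rate_bounds by (simp add: path_cov_def sum.cartesian_product)
    then have "(path_cov n k l)\<^sup>2
        = (\<Sum>(i, j)\<in>?I. root_rate ^ (i + j) * (?c i j k l / root_rate ^ (i + j)))\<^sup>2"
      by (rule arg_cong)
    also have "\<dots> \<le> (\<Sum>(i, j)\<in>?I. (root_rate ^ (i + j))\<^sup>2) * (\<Sum>(i, j)\<in>?I. (?c i j k l / root_rate ^ (i + j))\<^sup>2)"
      using Cauchy_Schwarz_ineq_sum[of "\<lambda>(i, j). root_rate ^ (i + j)"
          "\<lambda>(i, j). ?c i j k l / root_rate ^ (i + j)" ?I]
      by (simp add: case_prod_unfold)
    also have "\<dots> \<le> ?K * (\<Sum>(i, j)\<in>?I. 2 * \<bar>?c i j k l\<bar> / root_rate ^ (2 * (i + j)))"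
    proof (rule mult_mono)
      show "(\<Sum>(i, j)\<in>?I. (root_rate ^ (i + j))\<^sup>2) \<le> ?K"
        unfolding sq sum.cartesian_product[symmetric] by (rule sum_root_rate_mult_le) simp
      show "(\<Sum>(i, j)\<in>?I. (?c i j k l / root_rate ^ (i + j))\<^sup>2)
          \<le> (\<Sum>(i, j)\<in>?I. 2 * \<bar>?c i j k l\<bar> / root_rate ^ (2 * (i + j)))"
      proof (intro sum_mono, clarify)
        fix i j
        have "\<bar>?c i j k l\<bar> \<le> 2 * 1"
          using rate_bounds
          by (intro order.trans[OF abs_cell_cov_le] mult_left_mono power_le_one) auto
        then have "\<bar>?c i j k l\<bar> * \<bar>?c i j k l\<bar> \<le> 2 * \<bar>?c i j k l\<bar>"
          by (intro mult_right_mono) auto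
        then show "(?c i j k l / root_rate ^ (i + j))\<^sup>2 \<le> 2 * \<bar>?c i j k l\<bar> / root_rate ^ (2 * (i + j))"
          using root_rate_bounds unfolding power_divide sq
          by (intro divide_right_mono) (auto simp: power2_eq_square)
      qed
    qed (auto intro!: sum_nonneg)
    finally show ?thesis .
  qed
  then have "(\<Sum>k<b ^ n. \<Sum>l<b ^ n. (path_cov n k l)\<^sup>2)
      \<le> (\<Sum>k<b ^ n. \<Sum>l<b ^ n. ?K * (\<Sum>(i, j)\<in>?I. 2 * \<bar>?c i j k l\<bar> / root_rate ^ (2 * (i + j))))"
    by (intro sum_mono)
  also have "\<dots> = ?K * (\<Sum>p\<in>?I. \<Sum>k<b ^ n. \<Sum>l<b ^ n. 2 * \<bar>?c (fst p) (snd p) k l\<bar> / root_rate ^ (2 * (fst p + snd p)))"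
  proof -
    have "(\<Sum>k<b ^ n. \<Sum>l<b ^ n. \<Sum>p\<in>?I. F p k l) = (\<Sum>p\<in>?I. \<Sum>k<b ^ n. \<Sum>l<b ^ n. F p k l)" for F :: "_ \<Rightarrow> _ \<Rightarrow> _ \<Rightarrow> real"
    proof -
      have "(\<Sum>k<b ^ n. \<Sum>l<b ^ n. \<Sum>p\<in>?I. F p k l) = (\<Sum>k<b ^ n. \<Sum>p\<in>?I. \<Sum>l<b ^ n. F p k l)"
        by (rule sum.cong[OF refl], rule sum.swap)
      also have "\<dots> = (\<Sum>p\<in>?I. \<Sum>k<b ^ n. \<Sum>l<b ^ n. F p k l)" by (rule sum.swap)
      finally show ?thesis .
    qed
    then show ?thesis by (simp add: case_prod_unfold sum_distrib_left[symmetric])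
  qed
  also have "\<dots> \<le> ?K * (\<Sum>p\<in>?I. 48 * (real b ^ n)\<^sup>2 * root_rate ^ (2 * (fst p + snd p)))"
  proof (intro mult_left_mono sum_mono)
    fix p assume p: "p \<in> ?I"
    obtain i j where ij: "p = (i, j)" by (cases p)
    have "(\<Sum>k<b ^ n. \<Sum>l<b ^ n. 2 * \<bar>?c i j k l\<bar> / root_rate ^ (2 * (i + j)))
        = 2 / root_rate ^ (2 * (i + j)) * (\<Sum>k<b ^ n. \<Sum>l<b ^ n. \<bar>?c i j k l\<bar>)"
      by (simp add: sum_distrib_left)
    also have "\<dots> \<le> 2 / root_rate ^ (2 * (i + j)) * (24 * (real b ^ n)\<^sup>2 * root_rate ^ (4 * (i + j)))"
      using p ij root_rate_bounds by (intro mult_left_mono sum_indep_cell_cov_le) auto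
    also have "\<dots> = 48 * (real b ^ n)\<^sup>2 * root_rate ^ (2 * (i + j))"
    proof -
      have "root_rate ^ (4 * (i + j)) = root_rate ^ (2 * (i + j)) * root_rate ^ (2 * (i + j))"
        by (simp flip: power_add)
      then show ?thesis using root_rate_bounds by simp
    qed
    finally show "(\<Sum>k<b ^ n. \<Sum>l<b ^ n. 2 * \<bar>?c (fst p) (snd p) k l\<bar> / root_rate ^ (2 * (fst p + snd p)))
        \<le> 48 * (real b ^ n)\<^sup>2 * root_rate ^ (2 * (fst p + snd p))" by (simp add: ij)
  qed auto
  also have "\<dots> \<le> ?K * (48 * (real b ^ n)\<^sup>2 * ?K)"
  proof -
    have "(\<Sum>p\<in>?I. root_rate ^ (2 * (fst p + snd p))) \<le> ?K"
      using sum_root_rate_mult_le[of 2 n] by (simp only: sum.cartesian_product case_prod_unfold)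
    then show ?thesis
      unfolding sum_distrib_left[symmetric] by (intro mult_left_mono) auto
  qed
  also have "\<dots> = 48 * (1 / (1 - root_rate)) ^ 4 * (real b ^ n)\<^sup>2"
    using power_add[of "1 / (1 - root_rate)" 2 2] by simp
  finally show ?thesis .
qed

end

section \<open>Exponential and absolute moments of the normal law\<close>

lemma normal_density_mult_exp:
  assumes "0 < \<sigma>"
  shows "normal_density 0 \<sigma> x * exp (c * x) = exp (c\<^sup>2 * \<sigma>\<^sup>2 / 2) * normal_density (c * \<sigma>\<^sup>2) \<sigma> x"
proof -
  have "- (x - 0)\<^sup>2 / (2 * \<sigma>\<^sup>2) + c * x = c\<^sup>2 * \<sigma>\<^sup>2 / 2 + - (x - c * \<sigma>\<^sup>2)\<^sup>2 / (2 * \<sigma>\<^sup>2)"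
    using assms by (simp add: field_simps power2_eq_square)
  then have "exp (- (x - 0)\<^sup>2 / (2 * \<sigma>\<^sup>2)) * exp (c * x)
      = exp (c\<^sup>2 * \<sigma>\<^sup>2 / 2) * exp (- (x - c * \<sigma>\<^sup>2)\<^sup>2 / (2 * \<sigma>\<^sup>2))"
    by (simp only: exp_add[symmetric])
  then show ?thesis by (simp add: normal_density_def)
qed

lemma has_bochner_integral_normal_exp:
  assumes "0 < \<sigma>"
  shows "has_bochner_integral lborel (\<lambda>x. normal_density 0 \<sigma> x * exp (c * x)) (exp (c\<^sup>2 * \<sigma>\<^sup>2 / 2))"
  unfolding normal_density_mult_exp[OF assms]
  using has_bochner_integral_mult_right[of "exp (c\<^sup>2 * \<sigma>\<^sup>2 / 2)" lborel "normal_density (c * \<sigma>\<^sup>2) \<sigma>" 1] assms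
  by (auto simp: has_bochner_integral_iff)

lemma has_bochner_integral_normal_cosh:
  assumes "0 < \<sigma>"
  shows "has_bochner_integral lborel (\<lambda>x. normal_density 0 \<sigma> x * cosh x) (exp (\<sigma>\<^sup>2 / 2))"
proof -
  have "has_bochner_integral lborel
     (\<lambda>x. (normal_density 0 \<sigma> x * exp (1 * x) + normal_density 0 \<sigma> x * exp (-1 * x)) / 2)
     ((exp (1\<^sup>2 * \<sigma>\<^sup>2 / 2) + exp ((-1)\<^sup>2 * \<sigma>\<^sup>2 / 2)) / 2)"
    using assms
    by (intro has_bochner_integral_divide has_bochner_integral_add has_bochner_integral_normal_exp) auto
  then show ?thesis by (simp add: cosh_field_def algebra_simps add_divide_distrib)
qed

text \<open>The substitution t = x^2 / 2 turns the Gamma integral with parameter (q + 1) / 2 into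
  the moment over the positive half line, up to a constant factor; evenness doubles it.\<close>

lemma std_normal_abs_powr_moment:
  assumes "0 < q"
  shows "has_bochner_integral lborel (\<lambda>x. std_normal_density x * \<bar>x\<bar> powr q)
           (2 powr (q / 2) * Gamma ((q + 1) / 2) / sqrt pi)"
proof -
  define s where "s = (q + 1) / 2"
  let ?f = "\<lambda>t::real. t powr (s - 1) / exp t"
  have "(?f has_integral Gamma s) {0..}"
    using assms by (intro Gamma_integral_real) (simp add: s_def)
  then have "((\<lambda>t. if t \<in> {0<..} then ?f t else 0) has_integral Gamma s) {0..}"
    by (rule has_integral_eq[rotated]) auto
  then have hi: "(?f has_integral Gamma s) {0<..}"
    by (subst (asm) has_integral_restrict) auto
  have img: "(\<lambda>x::real. x\<^sup>2 / 2) ` {0<..} = {0<..}"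
  proof (intro set_eqI iffI)
    fix y :: real assume "y \<in> {0<..}"
    then show "y \<in> (\<lambda>x. x\<^sup>2 / 2) ` {0<..}" by (intro image_eqI[of _ _ "sqrt (2 * y)"]) auto
  qed auto
  have "?f absolutely_integrable_on (\<lambda>x. x\<^sup>2 / 2) ` {0<..} \<and> integral ((\<lambda>x. x\<^sup>2 / 2) ` {0<..}) ?f = Gamma s"
    unfolding img using hi by (auto intro!: nonnegative_absolutely_integrable_1)
  then have ch: "(\<lambda>x. \<bar>x\<bar> * ?f (x\<^sup>2 / 2)) absolutely_integrable_on {0<..} \<and>
       integral {0<..} (\<lambda>x. \<bar>x\<bar> * ?f (x\<^sup>2 / 2)) = Gamma s"
    by (subst has_absolute_integral_change_of_variables_1'[where g' = "\<lambda>x. x"])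
       (auto intro!: derivative_eq_intros simp: inj_on_def)
  then have "((\<lambda>x. \<bar>x\<bar> * ?f (x\<^sup>2 / 2)) has_integral Gamma s) {0<..}"
    unfolding has_integral_iff by (intro conjI set_lebesgue_integral_eq_integral(1)) (rule conjunct1, assumption, rule conjunct2)
  then have "((\<lambda>x. \<bar>x\<bar> * ?f (x\<^sup>2 / 2) * (2 powr (s - 1) / sqrt (2 * pi))) has_integral
        Gamma s * (2 powr (s - 1) / sqrt (2 * pi))) {0<..}"
    by (rule has_integral_mult_left)
  moreover have "\<bar>x\<bar> * ?f (x\<^sup>2 / 2) * (2 powr (s - 1) / sqrt (2 * pi)) = std_normal_density x * \<bar>x\<bar> powr q"
    if "x \<in> {0<..}" for x
  proof -
    have "x * (x\<^sup>2) powr (s - 1) = x powr q"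
      using that assms by (simp add: s_def powr_powr powr_mult_base diff_divide_distrib flip: powr_numeral)
    then show ?thesis
      using that by (simp add: std_normal_density_def powr_divide exp_minus field_simps)
  qed
  ultimately have hi2: "((\<lambda>x. std_normal_density x * \<bar>x\<bar> powr q) has_integral
        Gamma s * (2 powr (s - 1) / sqrt (2 * pi))) {0<..}"
    by (rule has_integral_eq[rotated]) auto
  \<comment> \<open>At 0 the integrand vanishes because 0 powr q = 0, so the open and the closed
    half line give the same function; the rule for even functions expects the closed one.\<close>
  have eq: "(\<lambda>x. indicator {0<..} x * (std_normal_density x * \<bar>x\<bar> powr q))
      = (\<lambda>x. indicator {0..} x *\<^sub>R (std_normal_density x * \<bar>x\<bar> powr q))"
    by (intro ext) (auto simp: indicator_def)
  have "has_bochner_integral lborel (\<lambda>x. indicator {0<..} x * (std_normal_density x * \<bar>x\<bar> powr q))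
      (Gamma s * (2 powr (s - 1) / sqrt (2 * pi)))"
    using assms nn_integral_has_integral_lebesgue[OF _ hi2]
    by (intro has_bochner_integral_nn_integral)
       (auto simp: s_def intro!: mult_nonneg_nonneg divide_nonneg_nonneg Gamma_real_nonneg)
  then have "has_bochner_integral lborel (\<lambda>x. std_normal_density x * \<bar>x\<bar> powr q)
      (2 *\<^sub>R (Gamma s * (2 powr (s - 1) / sqrt (2 * pi))))"
    unfolding eq by (rule has_bochner_integral_even_function) (simp add: std_normal_density_def)
  moreover have "2 *\<^sub>R (Gamma s * (2 powr (s - 1) / sqrt (2 * pi))) = 2 powr (q / 2) * Gamma s / sqrt pi"
  proof -
    have "2 * 2 powr (s - 1) = 2 powr (q / 2) * 2 powr (1 / 2)"
      by (simp add: s_def powr_mult_base flip: powr_add) (simp add: field_simps)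
    then show ?thesis by (simp add: powr_half_sqrt real_sqrt_mult field_simps)
  qed
  ultimately show ?thesis by (simp add: s_def)
qed

lemma integral_std_normal_abs_powr:
  assumes "0 < q"
  shows "(LINT x|std_normal_distribution. \<bar>x\<bar> powr q) = 2 powr (q / 2) * Gamma ((q + 1) / 2) / sqrt pi"
    and "integrable std_normal_distribution (\<lambda>x. \<bar>x\<bar> powr q)"
  using std_normal_abs_powr_moment[OF assms]
  by (auto simp: integral_density integrable_density has_bochner_integral_iff)

lemma integrable_std_normal_cosh: "integrable std_normal_distribution cosh"
  using has_bochner_integral_normal_cosh[of 1]
  by (subst integrable_density) (auto simp: has_bochner_integral_iff intro!: borel_measurable_continuous_onI continuous_intros)

section \<open>Moments of empirical distributions\<close>

text \<open>This is uniform integrability in pointwise form: cutting |x| powr q off at R costs at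
  most \<epsilon> cosh x, because cosh outgrows every power.\<close>

lemma abs_powr_le_cosh:
  fixes q \<epsilon> :: real
  assumes "0 < \<epsilon>" "0 < q"
  obtains R where "0 \<le> R" "\<And>x. \<bar>x\<bar> powr q \<le> R + \<epsilon> * cosh x"
proof -
  define k where "k = nat \<lceil>q\<rceil>"
  have "\<forall>\<^sub>F x::real in at_top. x ^ k / exp x < \<epsilon> / 2"
    using order_tendstoD(2)[OF tendsto_power_div_exp_0[of k], of "\<epsilon> / 2"] assms by simp
  then obtain A where A: "\<And>x. A \<le> x \<Longrightarrow> x ^ k / exp x < \<epsilon> / 2"
    by (auto simp: eventually_at_top_linorder)
  define R where "R = max 1 \<bar>A\<bar> powr q"
  have "\<bar>x\<bar> powr q \<le> R + \<epsilon> * cosh x" for x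
  proof (cases "\<bar>x\<bar> \<le> max 1 \<bar>A\<bar>")
    case True
    then have "\<bar>x\<bar> powr q \<le> R" unfolding R_def using assms by (intro powr_mono2) auto
    then show ?thesis using assms by (simp add: add_increasing2)
  next
    case False
    then have x: "1 \<le> \<bar>x\<bar>" "A \<le> \<bar>x\<bar>" by auto
    have "\<bar>x\<bar> powr q \<le> \<bar>x\<bar> powr real k"
      using x by (intro powr_mono) (auto simp: k_def intro: real_nat_ceiling_ge)
    also have "\<dots> = \<bar>x\<bar> ^ k" using x by (intro powr_realpow) auto
    also have "\<dots> \<le> \<epsilon> / 2 * exp \<bar>x\<bar>" using A[OF x(2)] by (simp add: field_simps)
    also have "\<dots> \<le> \<epsilon> * cosh \<bar>x\<bar>" using assms by (simp add: cosh_field_def field_simps)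
    finally show ?thesis by (simp add: R_def cosh_real_abs add_increasing)
  qed
  then show ?thesis by (intro that[of R]) (auto simp: R_def)
qed

lemma abs_le_cosh: "\<bar>x\<bar> \<le> cosh x" for x :: real
proof -
  have "1 + \<bar>x\<bar> / 2 \<le> exp (\<bar>x\<bar> / 2)" by (rule exp_ge_add_one_self)
  then have "(1 + \<bar>x\<bar> / 2)\<^sup>2 \<le> (exp (\<bar>x\<bar> / 2))\<^sup>2" by (intro power_mono) auto
  moreover have "(exp (\<bar>x\<bar> / 2))\<^sup>2 = exp \<bar>x\<bar>" by (simp add: power2_eq_square flip: exp_add)
  moreover have "2 * \<bar>x\<bar> \<le> (1 + \<bar>x\<bar> / 2)\<^sup>2"
    using zero_le_power2[of "\<bar>x\<bar> / 2 - 1"] by (simp add: power2_eq_square algebra_simps)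
  ultimately have "2 * \<bar>x\<bar> \<le> exp \<bar>x\<bar>" by linarith
  then have "\<bar>x\<bar> \<le> cosh \<bar>x\<bar>" by (simp add: cosh_field_def add_increasing2)
  then show ?thesis by simp
qed

text \<open>The empirical distribution, made symmetric so that its characteristic function is real.\<close>

definition empirical :: "nat \<Rightarrow> (nat \<Rightarrow> real) \<Rightarrow> real measure" where
  "empirical N x = distr (measure_pmf (pmf_of_set ({..<N} \<times> {- 1, 1}))) borel (\<lambda>(k, s). s * x k)"

lemma integral_empirical:
  fixes f :: "real \<Rightarrow> 'b::{banach, second_countable_topology}"
  assumes "0 < N" "f \<in> borel_measurable borel"
  shows "(LINT y|empirical N x. f y) = (\<Sum>k<N. (1 / (2 * real N)) *\<^sub>R (f (x k) + f (- x k)))"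
proof -
  let ?A = "{..<N} \<times> {- 1, 1 :: real}"
  have A: "finite ?A" "?A \<noteq> {}" "card ?A = 2 * N" using assms by (auto simp: card_cartesian_product)
  have "(LINT y|empirical N x. f y) = (LINT p|measure_pmf (pmf_of_set ?A). f (case p of (k, s) \<Rightarrow> s * x k))"
    unfolding empirical_def using assms by (intro integral_distr) auto
  also have "\<dots> = (\<Sum>p\<in>?A. pmf (pmf_of_set ?A) p *\<^sub>R f (case p of (k, s) \<Rightarrow> s * x k))"
    using A by (intro integral_measure_pmf) auto
  also have "\<dots> = (\<Sum>p\<in>?A. (1 / (2 * real N)) *\<^sub>R f (case p of (k, s) \<Rightarrow> s * x k))"
    using A by (intro sum.cong refl) (auto simp: pmf_of_set)
  also have "\<dots> = (\<Sum>k<N. \<Sum>s\<in>{- 1, 1}. (1 / (2 * real N)) *\<^sub>R f (s * x k))"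
    by (subst sum.cartesian_product) (simp add: case_prod_unfold)
  finally show ?thesis by (simp add: scaleR_add_right add.commute)
qed

lemma real_distribution_empirical: "0 < N \<Longrightarrow> real_distribution (empirical N x)"
  unfolding empirical_def
  by (intro prob_space.real_distribution_distr measure_pmf.prob_space_axioms) auto

text \<open>The random sign cancels the sine parts, so the averages of cosines alone determine the
  characteristic function.\<close>

lemma char_empirical:
  assumes "0 < N"
  shows "char (empirical N x) \<theta> = complex_of_real ((\<Sum>k<N. cos (\<theta> * x k)) / real N)"
proof -
  have "iexp (\<theta> * y) + iexp (\<theta> * - y) = complex_of_real (2 * cos (\<theta> * y))" for y
    by (simp add: complex_eq_iff exp_eq_polar cis.ctr flip: cis_conv_exp)
  then have "char (empirical N x) \<theta> = (\<Sum>k<N. (1 / (2 * real N)) *\<^sub>R complex_of_real (2 * cos (\<theta> * x k)))"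
    unfolding char_def using assms by (subst integral_empirical) (auto intro!: borel_measurable_continuous_onI continuous_intros)
  also have "\<dots> = complex_of_real (\<Sum>k<N. cos (\<theta> * x k) / real N)"
    using assms by (simp add: scaleR_conv_of_real)
  finally show ?thesis by (simp add: sum_divide_distrib)
qed

text \<open>An almost sure statement can be had for countably many frequencies at once; the
  Lipschitz bound, uniform in n, extends it to all real ones.\<close>

lemma tendsto_of_uniformly_lipschitz_Rats:
  fixes F :: "nat \<Rightarrow> real \<Rightarrow> real" and g :: "real \<Rightarrow> real"
  assumes conv: "\<And>r. r \<in> \<rat> \<Longrightarrow> (\<lambda>n. F n r) \<longlonglongrightarrow> g r"
    and lip: "\<And>n x y. \<bar>F n x - F n y\<bar> \<le> B * \<bar>x - y\<bar>"
    and g: "isCont g x"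
  shows "(\<lambda>n. F n x) \<longlonglongrightarrow> g x"
proof (rule LIMSEQ_I)
  fix e :: real assume e: "0 < e"
  have B: "0 \<le> B" using order.trans[OF abs_ge_zero lip[of 0 0 1]] by simp
  obtain d where d: "0 < d" "\<And>y. \<bar>y - x\<bar> < d \<Longrightarrow> \<bar>g y - g x\<bar> < e / 3"
    using g e unfolding continuous_at_eps_delta dist_real_def by (metis zero_less_divide_iff zero_less_numeral)
  define d' where "d' = min d (e / (3 * (B + 1)))"
  have d': "0 < d'" using d e B by (simp add: d'_def)
  obtain r where r: "r \<in> \<rat>" "x < r" "r < x + d'" using Rats_dense_in_real[of x "x + d'"] d' by auto
  obtain n0 where n0: "\<And>n. n0 \<le> n \<Longrightarrow> \<bar>F n r - g r\<bar> < e / 3"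
    using LIMSEQ_D[OF conv[OF r(1)], of "e / 3"] e by auto
  have Bx: "B * \<bar>x - r\<bar> \<le> e / 3"
  proof -
    have "B * \<bar>x - r\<bar> \<le> (B + 1) * (e / (3 * (B + 1)))"
      using B r by (intro mult_mono) (auto simp: d'_def)
    also have "\<dots> = e / 3" using nonzero_mult_divide_mult_cancel_left[of "B + 1" e 3] B by (simp add: mult.commute)
    finally show ?thesis .
  qed
  show "\<exists>no. \<forall>n\<ge>no. norm (F n x - g x) < e"
  proof (intro exI[of _ n0] allI impI)
    fix n assume "n0 \<le> n"
    then have "\<bar>F n r - g r\<bar> < e / 3" by (rule n0)
    moreover have "\<bar>g r - g x\<bar> < e / 3" using r by (intro d) (auto simp: d'_def)
    moreover have "\<bar>F n x - F n r\<bar> \<le> e / 3" using lip[of n x r] Bx by linarith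
    ultimately show "norm (F n x - g x) < e" by (simp add: abs_if split: if_splits)
  qed
qed

lemma abs_cos_diff_le: "\<bar>cos x - cos y\<bar> \<le> \<bar>x - y\<bar>" for x y :: real
proof -
  have "\<bar>cos x - cos y\<bar> = 2 * \<bar>sin ((x + y) / 2)\<bar> * \<bar>sin ((y - x) / 2)\<bar>"
    by (simp add: cos_diff_cos abs_mult)
  also have "\<dots> \<le> 2 * 1 * \<bar>(y - x) / 2\<bar>"
    using abs_sin_x_le_abs_x[of "(y - x) / 2"] by (intro mult_mono) auto
  finally show ?thesis by simp
qed

text \<open>A deterministic statement, applied to one sample point at a time. The bound on cosh acts
  twice: through |x| \<le> cosh x it makes the averages of cosines Lipschitz in the frequency, and
  it controls the part of the moment lost by truncation.\<close>

lemma empirical_moment_tendsto: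
  fixes x :: "nat \<Rightarrow> nat \<Rightarrow> real" and N :: "nat \<Rightarrow> nat"
  assumes N: "\<And>n. 0 < N n" and q: "0 < q"
    and conv: "\<And>\<theta>. \<theta> \<in> \<rat> \<Longrightarrow> (\<lambda>n. (\<Sum>k<N n. cos (\<theta> * x n k)) / real (N n)) \<longlonglongrightarrow> exp (- \<theta>\<^sup>2 / 2)"
    and bound: "\<And>n. (\<Sum>k<N n. cosh (x n k)) / real (N n) \<le> B"
  shows "(\<lambda>n. (\<Sum>k<N n. \<bar>x n k\<bar> powr q) / real (N n))
           \<longlonglongrightarrow> (LINT y|std_normal_distribution. \<bar>y\<bar> powr q)"
proof -
  let ?m = "LINT y|std_normal_distribution. \<bar>y\<bar> powr q"
  let ?A = "\<lambda>f n. (\<Sum>k<N n. f (x n k)) / real (N n)"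
  interpret Z: real_distribution std_normal_distribution by (rule real_dist_normal_dist)
  have mono: "?A f n \<le> ?A g n" if "\<And>y. f y \<le> g y" for f g :: "real \<Rightarrow> real" and n
    by (intro divide_right_mono sum_mono that) auto
  have B: "0 \<le> B" using order.trans[OF _ bound[of 0]] by (simp add: sum_nonneg)
  have lip: "\<bar>?A (\<lambda>y. cos (a * y)) n - ?A (\<lambda>y. cos (c * y)) n\<bar> \<le> B * \<bar>a - c\<bar>" for a c n
  proof -
    have "\<bar>?A (\<lambda>y. cos (a * y)) n - ?A (\<lambda>y. cos (c * y)) n\<bar>
        = \<bar>\<Sum>k<N n. cos (a * x n k) - cos (c * x n k)\<bar> / real (N n)"
      by (simp add: sum_subtractf diff_divide_distrib abs_divide flip: diff_divide_distrib)
    also have "\<dots> \<le> (\<Sum>k<N n. \<bar>a - c\<bar> * cosh (x n k)) / real (N n)"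
    proof (intro divide_right_mono order.trans[OF sum_abs] sum_mono)
      fix k
      have "\<bar>cos (a * x n k) - cos (c * x n k)\<bar> \<le> \<bar>a * x n k - c * x n k\<bar>" by (rule abs_cos_diff_le)
      also have "\<dots> = \<bar>a - c\<bar> * \<bar>x n k\<bar>" by (simp flip: abs_mult left_diff_distrib)
      also have "\<dots> \<le> \<bar>a - c\<bar> * cosh (x n k)" by (intro mult_left_mono abs_le_cosh) auto
      finally show "\<bar>cos (a * x n k) - cos (c * x n k)\<bar> \<le> \<bar>a - c\<bar> * cosh (x n k)" .
    qed simp
    also have "\<dots> = \<bar>a - c\<bar> * ?A cosh n" by (simp add: sum_distrib_left)
    also have "\<dots> \<le> \<bar>a - c\<bar> * B" by (intro mult_left_mono bound) auto
    finally show ?thesis by (simp add: mult.commute)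
  qed
  have "(\<lambda>n. ?A (\<lambda>y. cos (\<theta> * y)) n) \<longlonglongrightarrow> exp (- \<theta>\<^sup>2 / 2)" for \<theta>
    by (rule tendsto_of_uniformly_lipschitz_Rats[of "\<lambda>n \<theta>. ?A (\<lambda>y. cos (\<theta> * y)) n" "\<lambda>\<theta>. exp (- \<theta>\<^sup>2 / 2)", OF conv lip])
       (auto intro!: continuous_intros)
  then have "(\<lambda>n. char (empirical (N n) (x n)) \<theta>) \<longlonglongrightarrow> char std_normal_distribution \<theta>" for \<theta>
    unfolding char_empirical[OF N] char_std_normal_distribution by (intro tendsto_of_real)
  then have weak: "weak_conv_m (\<lambda>n. empirical (N n) (x n)) std_normal_distribution"
    using N by (intro levy_continuity real_distribution_empirical real_dist_normal_dist) auto
  have trunc: "(\<lambda>n. ?A (\<lambda>y. min (\<bar>y\<bar> powr q) R) n) \<longlonglongrightarrow> (LINT y|std_normal_distribution. min (\<bar>y\<bar> powr q) R)"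
    if R: "0 \<le> R" for R
  proof -
    have c: "isCont (\<lambda>y. min (\<bar>y\<bar> powr q) R) y" for y
    proof -
      have "((\<lambda>y. \<bar>y\<bar> powr q) \<longlongrightarrow> \<bar>y\<bar> powr q) (at y)"
        using q by (intro tendsto_powr' tendsto_intros) auto
      then show ?thesis unfolding isCont_def by (intro tendsto_min tendsto_const)
    qed
    have "(\<lambda>n. LINT y|empirical (N n) (x n). min (\<bar>y\<bar> powr q) R)
        \<longlonglongrightarrow> (LINT y|std_normal_distribution. min (\<bar>y\<bar> powr q) R)"
      by (rule weak_conv_imp_integral_bdd_continuous_conv[OF real_distribution_empirical[OF N]
            real_dist_normal_dist weak c, of R]) (use R in auto)
    moreover have "(LINT y|empirical (N n) (x n). min (\<bar>y\<bar> powr q) R) = ?A (\<lambda>y. min (\<bar>y\<bar> powr q) R) n" for n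
      using N[of n] by (subst integral_empirical) (auto simp: sum_divide_distrib)
    ultimately show ?thesis by simp
  qed
  define B' where "B' = (LINT y|std_normal_distribution. cosh y)"
  have B': "0 \<le> B'" unfolding B'_def by (intro Bochner_Integration.integral_nonneg) simp
  show ?thesis
  proof (rule LIMSEQ_I)
    fix e :: real assume e: "0 < e"
    \<comment> \<open>Chosen so that the truncation errors of the empirical moment and of the normal
      moment are each at most e / 3.\<close>
    define \<epsilon> where "\<epsilon> = e / (3 * (B + B' + 1))"
    have \<epsilon>: "0 < \<epsilon>" using e B B' by (simp add: \<epsilon>_def)
    have \<epsilon>B: "\<epsilon> * B \<le> e / 3" "\<epsilon> * B' \<le> e / 3"
      using e B B' by (auto simp: \<epsilon>_def field_simps)
    obtain R where R: "0 \<le> R" "\<And>y. \<bar>y\<bar> powr q \<le> R + \<epsilon> * cosh y"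
      using abs_powr_le_cosh[OF \<epsilon> q] by blast
    let ?t = "\<lambda>y. min (\<bar>y\<bar> powr q) R"
    have t: "\<bar>y\<bar> powr q \<le> ?t y + \<epsilon> * cosh y" for y
      using R(2)[of y] \<epsilon> by (auto simp: min_def)
    have it: "integrable std_normal_distribution ?t"
      using R by (intro Z.integrable_const_bound[of _ R]) auto
    have ms: "?m \<le> (LINT y|std_normal_distribution. ?t y) + \<epsilon> * B'" "(LINT y|std_normal_distribution. ?t y) \<le> ?m"
    proof -
      have "?m \<le> (LINT y|std_normal_distribution. ?t y + \<epsilon> * cosh y)"
        using it integrable_std_normal_cosh integral_std_normal_abs_powr(2)[OF q] t
        by (intro integral_mono) auto
      then show "?m \<le> (LINT y|std_normal_distribution. ?t y) + \<epsilon> * B'"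
        using it integrable_std_normal_cosh by (simp add: B'_def)
      show "(LINT y|std_normal_distribution. ?t y) \<le> ?m"
        using it integral_std_normal_abs_powr(2)[OF q] by (intro integral_mono) auto
    qed
    obtain n0 where n0: "\<And>n. n0 \<le> n \<Longrightarrow> \<bar>?A ?t n - (LINT y|std_normal_distribution. ?t y)\<bar> < e / 3"
      using LIMSEQ_D[OF trunc[OF R(1)], of "e / 3"] e by auto
    show "\<exists>no. \<forall>n\<ge>no. norm (?A (\<lambda>y. \<bar>y\<bar> powr q) n - ?m) < e"
    proof (intro exI[of _ n0] allI impI)
      fix n assume n: "n0 \<le> n"
      have "?A (\<lambda>y. \<bar>y\<bar> powr q) n \<le> ?A (\<lambda>y. ?t y + \<epsilon> * cosh y) n" by (intro mono t)
      also have "\<dots> = ?A ?t n + \<epsilon> * ?A cosh n"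
        by (simp add: sum.distrib sum_distrib_left add_divide_distrib)
      also have "\<dots> \<le> ?A ?t n + \<epsilon> * B" using \<epsilon> by (intro add_left_mono mult_left_mono bound) auto
      finally have up: "?A (\<lambda>y. \<bar>y\<bar> powr q) n \<le> ?A ?t n + \<epsilon> * B" .
      have lo: "?A ?t n \<le> ?A (\<lambda>y. \<bar>y\<bar> powr q) n" by (intro mono) auto
      show "norm (?A (\<lambda>y. \<bar>y\<bar> powr q) n - ?m) < e"
        unfolding real_norm_def abs_less_iff using up lo ms \<epsilon>B n0[OF n, unfolded abs_less_iff] by linarith
    qed
  qed
qed

section \<open>Centered Gaussian variables and almost sure convergence\<close>

context prob_space
begin

text \<open>The formulas depend on the law through the second moment only, so they also cover the
  degenerate case.\<close>

lemma centered_gaussian_rv: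
  assumes "gaussian_rv M X" "expectation X = 0"
  shows "integrable M (\<lambda>\<omega>. (X \<omega>)\<^sup>2)"
    and "integrable M (\<lambda>\<omega>. cosh (X \<omega>))"
    and "expectation (\<lambda>\<omega>. cosh (X \<omega>)) = exp (expectation (\<lambda>\<omega>. (X \<omega>)\<^sup>2) / 2)"
    and "expectation (\<lambda>\<omega>. cos (X \<omega>)) = exp (- expectation (\<lambda>\<omega>. (X \<omega>)\<^sup>2) / 2)"
proof -
  have [measurable]: "X \<in> borel_measurable M" using assms by (simp add: gaussian_rv_def)
  have [measurable]: "cosh \<in> borel_measurable (borel :: real measure)"
    by (intro borel_measurable_continuous_onI continuous_intros)
  consider \<mu> where "AE \<omega> in M. X \<omega> = \<mu>" | \<mu> \<sigma> where "\<sigma> > 0" "distributed M lborel X (normal_density \<mu> \<sigma>)"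
    using assms unfolding gaussian_rv_def by blast
  then have "integrable M (\<lambda>\<omega>. (X \<omega>)\<^sup>2) \<and> integrable M (\<lambda>\<omega>. cosh (X \<omega>)) \<and>
    expectation (\<lambda>\<omega>. cosh (X \<omega>)) = exp (expectation (\<lambda>\<omega>. (X \<omega>)\<^sup>2) / 2) \<and>
    expectation (\<lambda>\<omega>. cos (X \<omega>)) = exp (- expectation (\<lambda>\<omega>. (X \<omega>)\<^sup>2) / 2)"
  proof cases
    case 1
    \<comment> \<open>A point mass with mean zero sits at 0, where cosh and cos equal 1 = exp
      0.\<close>
    then have "expectation X = expectation (\<lambda>\<omega>. \<mu>)" by (intro integral_cong_AE) auto
    then have "AE \<omega> in M. X \<omega> = 0" using 1 assms prob_space by simp
    then have *: "has_bochner_integral M (\<lambda>\<omega>. g (X \<omega>)) (g 0)"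
      if [measurable]: "g \<in> borel_measurable borel" for g :: "real \<Rightarrow> real"
    proof -
      have ae: "AE \<omega> in M. g (X \<omega>) = g 0" using \<open>AE \<omega> in M. X \<omega> = 0\<close> by eventually_elim simp
      have "integrable M (\<lambda>\<omega>. g (X \<omega>)) \<longleftrightarrow> integrable M (\<lambda>\<omega>. g 0)"
        using ae by (intro integrable_cong_AE) auto
      moreover have "expectation (\<lambda>\<omega>. g (X \<omega>)) = expectation (\<lambda>\<omega>. g 0)"
        using ae by (intro integral_cong_AE) auto
      ultimately show ?thesis using prob_space by (simp add: has_bochner_integral_iff)
    qed
    show ?thesis using *[of "\<lambda>x. x\<^sup>2"] *[of cosh] *[of cos] by (auto simp: has_bochner_integral_iff)
  next
    case 2
    then have "\<mu> = 0" using normal_distributed_expectation assms by metis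
    with 2 have \<sigma>: "\<sigma> > 0" and D: "distributed M lborel X (normal_density 0 \<sigma>)" by auto
    have v: "expectation (\<lambda>\<omega>. (X \<omega>)\<^sup>2) = \<sigma>\<^sup>2"
      using normal_distributed_variance[OF \<sigma> D] assms by simp
    have "integrable lborel (\<lambda>x. normal_density 0 \<sigma> x * x\<^sup>2)"
      using integrable_normal_moment[OF \<sigma>, of 0 2] by simp
    then have i2: "integrable M (\<lambda>\<omega>. (X \<omega>)\<^sup>2)"
      using distributed_integrable[OF D, of "\<lambda>x. x\<^sup>2"] by simp
    have ic: "integrable M (\<lambda>\<omega>. cosh (X \<omega>))"
      using distributed_integrable[OF D, of cosh] has_bochner_integral_normal_cosh[OF \<sigma>]
      by (simp add: has_bochner_integral_iff)
    have ec: "expectation (\<lambda>\<omega>. cosh (X \<omega>)) = exp (\<sigma>\<^sup>2 / 2)"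
      using distributed_integral[OF D, of cosh] has_bochner_integral_normal_cosh[OF \<sigma>]
      by (simp add: has_bochner_integral_iff)
    have DZ: "distributed M lborel (\<lambda>\<omega>. (X \<omega> - 0) / \<sigma>) std_normal_density"
      using D normal_standard_normal_convert[OF \<sigma>, of X 0] by simp
    interpret Z: real_distribution std_normal_distribution by (rule real_dist_normal_dist)
    have "expectation (\<lambda>\<omega>. cos (X \<omega>)) = expectation (\<lambda>\<omega>. cos (\<sigma> * ((X \<omega> - 0) / \<sigma>)))"
      using \<sigma> by simp
    also have "\<dots> = (LINT x|lborel. std_normal_density x * cos (\<sigma> * x))"
      by (rule distributed_integral[OF DZ, of "\<lambda>x. cos (\<sigma> * x)", symmetric]) auto
    also have "\<dots> = (LINT x|std_normal_distribution. cos (\<sigma> * x))"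
      by (subst integral_density) auto
    also have "\<dots> = (LINT x|std_normal_distribution. Re (iexp (\<sigma> * x)))"
      by (simp add: Re_exp)
    also have "\<dots> = Re (char std_normal_distribution \<sigma>)"
      unfolding char_def by (intro integral_Re Z.integrable_const_bound[of _ 1]) auto
    also have "\<dots> = exp (- \<sigma>\<^sup>2 / 2)" by (simp add: char_std_normal_distribution)
    finally show ?thesis using i2 ic ec v by simp
  qed
  then show "integrable M (\<lambda>\<omega>. (X \<omega>)\<^sup>2)"
    and "integrable M (\<lambda>\<omega>. cosh (X \<omega>))"
    and "expectation (\<lambda>\<omega>. cosh (X \<omega>)) = exp (expectation (\<lambda>\<omega>. (X \<omega>)\<^sup>2) / 2)"
    and "expectation (\<lambda>\<omega>. cos (X \<omega>)) = exp (- expectation (\<lambda>\<omega>. (X \<omega>)\<^sup>2) / 2)"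
    by blast+
qed

text \<open>The series of squares has finite expectation, hence is finite almost surely, and its
  terms tend to 0.\<close>

lemma AE_tendsto_0_of_summable_second_moments:
  assumes "\<And>n. integrable M (\<lambda>\<omega>. (X n \<omega>)\<^sup>2)"
    and "summable (\<lambda>n. expectation (\<lambda>\<omega>. (X n \<omega>)\<^sup>2))"
  shows "AE \<omega> in M. (\<lambda>n. X n \<omega> :: real) \<longlonglongrightarrow> 0"
proof -
  have "(\<integral>\<^sup>+\<omega>. (\<Sum>n. ennreal ((X n \<omega>)\<^sup>2)) \<partial>M) = (\<Sum>n. \<integral>\<^sup>+\<omega>. ennreal ((X n \<omega>)\<^sup>2) \<partial>M)"
    using assms(1) by (intro nn_integral_suminf) auto
  also have "\<dots> = (\<Sum>n. ennreal (expectation (\<lambda>\<omega>. (X n \<omega>)\<^sup>2)))"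
    using assms(1) by (intro suminf_cong nn_integral_eq_integral) auto
  also have "\<dots> = ennreal (\<Sum>n. expectation (\<lambda>\<omega>. (X n \<omega>)\<^sup>2))"
    using assms(2) by (intro suminf_ennreal2) auto
  finally have "(\<integral>\<^sup>+\<omega>. (\<Sum>n. ennreal ((X n \<omega>)\<^sup>2)) \<partial>M) \<noteq> \<infinity>" by simp
  then have "AE \<omega> in M. (\<Sum>n. ennreal ((X n \<omega>)\<^sup>2)) \<noteq> \<infinity>"
    using assms(1) by (intro nn_integral_PInf_AE borel_measurable_suminf_order) auto
  then show ?thesis
  proof eventually_elim
    case (elim \<omega>)
    then have "summable (\<lambda>n. (X n \<omega>)\<^sup>2)" by (intro summable_suminf_not_top) auto
    then have "(\<lambda>n. (X n \<omega>)\<^sup>2) \<longlonglongrightarrow> 0" by (rule summable_LIMSEQ_zero)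
    then have "(\<lambda>n. sqrt ((X n \<omega>)\<^sup>2)) \<longlonglongrightarrow> sqrt 0" by (rule tendsto_real_sqrt)
    then show ?case by (simp add: tendsto_rabs_zero_iff)
  qed
qed

end

section \<open>Variance of sums of cosines and hyperbolic cosines\<close>

lemma abs_sinh_le: "\<bar>sinh x\<bar> \<le> \<bar>x\<bar> * cosh x" for x :: real
proof -
  have "sinh y \<le> y * cosh y" if "0 < y" for y :: real
  proof -
    have D: "(sinh has_real_derivative cosh z) (at z)" for z :: real
      by (auto intro!: derivative_eq_intros)
    obtain z where z: "0 < z" "z < y" "sinh y - sinh 0 = (y - 0) * cosh z"
      using MVT2[OF \<open>0 < y\<close> D] by blast
    moreover have "cosh z \<le> cosh y" using z by (subst cosh_real_nonneg_le_iff) auto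
    ultimately show ?thesis using \<open>0 < y\<close> by simp
  qed
  from this[of "\<bar>x\<bar>"] show ?thesis by (cases "x = 0") (auto simp flip: sinh_real_abs)
qed

text \<open>cosh u - 1 = 2 (sinh (u / 2))^2 vanishes to second order at 0. With u a covariance, this
  is the source of the squared covariance in the variance bound.\<close>

lemma cosh_minus_1_le:
  fixes u C :: real
  assumes "\<bar>u\<bar> \<le> C"
  shows "cosh u - 1 \<le> u\<^sup>2 * (cosh C)\<^sup>2"
proof -
  have "cosh u = cosh (2 * (u / 2))" by simp
  also have "\<dots> = 1 + 2 * (sinh (u / 2))\<^sup>2"
    unfolding cosh_double using cosh_square_eq[of "u / 2"] by simp
  finally have "cosh u - 1 = 2 * \<bar>sinh (u / 2)\<bar>\<^sup>2" by simp
  also have "\<dots> \<le> 2 * (\<bar>u / 2\<bar> * cosh (u / 2))\<^sup>2" by (intro mult_left_mono power_mono abs_sinh_le) auto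
  also have "\<dots> \<le> 2 * (\<bar>u / 2\<bar> * cosh C)\<^sup>2"
  proof -
    have "cosh \<bar>u / 2\<bar> \<le> cosh C" using assms by (subst cosh_real_nonneg_le_iff) auto
    then have "cosh (u / 2) \<le> cosh C" by (simp only: cosh_real_abs)
    then show ?thesis by (intro mult_left_mono power_mono) auto
  qed
  also have "\<dots> \<le> u\<^sup>2 * (cosh C)\<^sup>2" by (simp add: power_mult_distrib power_divide)
  finally show ?thesis .
qed

lemma abs_exp_diff_le: "\<bar>x\<bar> \<le> C \<Longrightarrow> \<bar>y\<bar> \<le> C \<Longrightarrow> \<bar>exp x - exp y\<bar> \<le> exp C * \<bar>x - y\<bar>" for x y C :: real
proof -
  have *: "exp y - exp x \<le> exp C * (y - x)" if "x \<le> y" "y \<le> C" for x y :: real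
  proof -
    have "exp y - exp x = exp y * (1 - exp (x - y))" by (simp add: exp_diff algebra_simps)
    also have "\<dots> \<le> exp y * (y - x)" using exp_ge_add_one_self[of "x - y"] by (intro mult_left_mono; linarith?) simp
    also have "\<dots> \<le> exp C * (y - x)" using that by (intro mult_right_mono) auto
    finally show ?thesis .
  qed
  assume "\<bar>x\<bar> \<le> C" "\<bar>y\<bar> \<le> C"
  then have "x \<le> C" "y \<le> C" by auto
  then show ?thesis using *[of x y] *[of y x] by (cases "x \<le> y") (auto simp: abs_of_nonneg abs_of_nonpos abs_minus_commute)
qed

text \<open>The sign e is -1 for cos and 1 for cosh. The addition formula reduces a product of two
  terms to f of a sum and of a difference, and the covariance of f (Z k) and f (Z l) becomes exp (e
  (v k k + v l l) / 2) (cosh (v k l) - 1), where e has dropped out of cosh by evenness.\<close>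

lemma (in prob_space) second_moment_centered_sum:
  fixes f :: "real \<Rightarrow> real" and Z :: "nat \<Rightarrow> 'a \<Rightarrow> real" and e :: real
  assumes f: "\<And>x y. f x * f y = (f (x + y) + f (x - y)) / 2"
    and int: "\<And>k l. integrable M (\<lambda>\<omega>. f (Z k \<omega> + Z l \<omega>))" "\<And>k l. integrable M (\<lambda>\<omega>. f (Z k \<omega> - Z l \<omega>))"
      "\<And>k. integrable M (\<lambda>\<omega>. f (Z k \<omega>))"
    and E1: "\<And>k. expectation (\<lambda>\<omega>. f (Z k \<omega>)) = exp (e * v k k / 2)"
    and E2: "\<And>k l. expectation (\<lambda>\<omega>. f (Z k \<omega> + Z l \<omega>)) = exp (e * (v k k + 2 * v k l + v l l) / 2)"
      "\<And>k l. expectation (\<lambda>\<omega>. f (Z k \<omega> - Z l \<omega>)) = exp (e * (v k k - 2 * v k l + v l l) / 2)"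
    and e: "\<bar>e\<bar> = 1" and C: "\<And>k l. \<bar>v k l\<bar> \<le> C"
  shows "integrable M (\<lambda>\<omega>. (\<Sum>k<N. f (Z k \<omega>) - exp (e * v k k / 2))\<^sup>2)"
    and "expectation (\<lambda>\<omega>. (\<Sum>k<N. f (Z k \<omega>) - exp (e * v k k / 2))\<^sup>2)
          \<le> exp C * (cosh C)\<^sup>2 * (\<Sum>k<N. \<Sum>l<N. (v k l)\<^sup>2)"
proof -
  let ?a = "\<lambda>k. exp (e * v k k / 2)"
  let ?g = "\<lambda>k l \<omega>. (f (Z k \<omega>) - ?a k) * (f (Z l \<omega>) - ?a l)"
  have g: "?g k l \<omega> = (f (Z k \<omega> + Z l \<omega>) + f (Z k \<omega> - Z l \<omega>)) / 2 - ?a l * f (Z k \<omega>) - ?a k * f (Z l \<omega>) + ?a k * ?a l" for k l \<omega>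
    unfolding f[symmetric] by (simp add: algebra_simps)
  have ig: "integrable M (?g k l)" for k l unfolding g using int by auto
  have eg: "expectation (?g k l) = exp (e * (v k k + v l l) / 2) * (cosh (v k l) - 1)" for k l
  proof -
    have "expectation (?g k l) = (exp (e * (v k k + 2 * v k l + v l l) / 2) + exp (e * (v k k - 2 * v k l + v l l) / 2)) / 2
        - ?a l * ?a k - ?a k * ?a l + ?a k * ?a l"
      unfolding g using int E1 E2 prob_space by simp
    also have "\<dots> = exp (e * (v k k + v l l) / 2) * (cosh (e * v k l) - 1)"
      by (simp add: cosh_field_def exp_add[symmetric] algebra_simps add_divide_distrib diff_divide_distrib)
    also have "cosh (e * v k l) = cosh (v k l)" using e by (auto simp: abs_if split: if_splits)
    finally show ?thesis .
  qed
  have sq: "(\<Sum>k<N. f (Z k \<omega>) - ?a k)\<^sup>2 = (\<Sum>k<N. \<Sum>l<N. ?g k l \<omega>)" for \<omega>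
    by (simp add: power2_eq_square sum_product)
  show "integrable M (\<lambda>\<omega>. (\<Sum>k<N. f (Z k \<omega>) - ?a k)\<^sup>2)" unfolding sq using ig by auto
  have "expectation (\<lambda>\<omega>. (\<Sum>k<N. f (Z k \<omega>) - ?a k)\<^sup>2) = (\<Sum>k<N. \<Sum>l<N. expectation (?g k l))"
    unfolding sq using ig by (simp add: integral_sum)
  also have "\<dots> \<le> (\<Sum>k<N. \<Sum>l<N. exp C * (cosh C)\<^sup>2 * (v k l)\<^sup>2)"
  proof (intro sum_mono)
    fix k l
    have "e * (v k k + v l l) \<le> \<bar>e\<bar> * \<bar>v k k + v l l\<bar>" by (simp flip: abs_mult)
    then have "e * (v k k + v l l) / 2 \<le> C" using e C[of k k] C[of l l] by auto
    moreover have "1 \<le> cosh (v k l)" by (rule cosh_real_ge_1)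
    ultimately have "expectation (?g k l) \<le> exp C * ((v k l)\<^sup>2 * (cosh C)\<^sup>2)"
      unfolding eg by (intro mult_mono cosh_minus_1_le C) auto
    then show "expectation (?g k l) \<le> exp C * (cosh C)\<^sup>2 * (v k l)\<^sup>2" by (simp add: mult_ac)
  qed
  finally show "expectation (\<lambda>\<omega>. (\<Sum>k<N. f (Z k \<omega>) - ?a k)\<^sup>2) \<le> exp C * (cosh C)\<^sup>2 * (\<Sum>k<N. \<Sum>l<N. (v k l)\<^sup>2)"
    by (simp add: sum_distrib_left)
qed

section \<open>The linear span of the fractional Brownian motion\<close>

locale fbm_grid = prob_space M + badic_grid H b
  for M :: "'a measure" and H :: real and b :: nat +
  fixes W :: "real \<Rightarrow> 'a \<Rightarrow> real"
  assumes fbm: "continuous_fBm M H W"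
begin

text \<open>Explicit finite combinations are exactly what \<open>gaussian_process\<close> speaks of.
  Closure under sums and differences makes every combination that occurs a centered Gaussian
  variable, without any joint law.\<close>

definition in_span :: "('a \<Rightarrow> real) \<Rightarrow> bool" where
  "in_span X \<longleftrightarrow> (\<exists>J c. finite J \<and> J \<subseteq> {0..1} \<and> X = (\<lambda>\<omega>. \<Sum>t\<in>J. c t * W t \<omega>))"

lemma in_span_W: "t \<in> {0..1} \<Longrightarrow> in_span (W t)"
  unfolding in_span_def by (intro exI[of _ "{t}"] exI[of _ "\<lambda>_. 1"]) auto

lemma in_span_zero: "in_span (\<lambda>_. 0)"
  unfolding in_span_def by (intro exI[of _ "{}"]) auto

lemma in_span_cmult:
  assumes "in_span X" shows "in_span (\<lambda>\<omega>. a * X \<omega>)"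
proof -
  obtain J c where "finite J" "J \<subseteq> {0..1}" "X = (\<lambda>\<omega>. \<Sum>t\<in>J. c t * W t \<omega>)"
    using assms unfolding in_span_def by blast
  then show ?thesis unfolding in_span_def
    by (intro exI[of _ J] exI[of _ "\<lambda>t. a * c t"]) (auto simp: sum_distrib_left mult.assoc)
qed

lemma in_span_add:
  assumes "in_span X" "in_span Y" shows "in_span (\<lambda>\<omega>. X \<omega> + Y \<omega>)"
proof -
  obtain J c where J: "finite J" "J \<subseteq> {0..1}" "X = (\<lambda>\<omega>. \<Sum>t\<in>J. c t * W t \<omega>)"
    using assms unfolding in_span_def by blast
  obtain K d where K: "finite K" "K \<subseteq> {0..1}" "Y = (\<lambda>\<omega>. \<Sum>t\<in>K. d t * W t \<omega>)"
    using assms unfolding in_span_def by blast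
  have "(\<Sum>t\<in>J. c t * W t \<omega>) + (\<Sum>t\<in>K. d t * W t \<omega>)
      = (\<Sum>t\<in>J \<union> K. ((if t \<in> J then c t else 0) + (if t \<in> K then d t else 0)) * W t \<omega>)" for \<omega>
  proof -
    have "(\<Sum>t\<in>J. c t * W t \<omega>) = (\<Sum>t\<in>J \<union> K. (if t \<in> J then c t else 0) * W t \<omega>)"
      using J K by (intro sum.mono_neutral_cong_left) auto
    moreover have "(\<Sum>t\<in>K. d t * W t \<omega>) = (\<Sum>t\<in>J \<union> K. (if t \<in> K then d t else 0) * W t \<omega>)"
      using J K by (intro sum.mono_neutral_cong_left) auto
    ultimately show ?thesis by (simp only: sum.distrib distrib_right)
  qed
  then show ?thesis unfolding in_span_def using J K
    by (intro exI[of _ "J \<union> K"] exI[of _ "\<lambda>t. (if t \<in> J then c t else 0) + (if t \<in> K then d t else 0)"]) auto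
qed

lemma in_span_diff: "in_span X \<Longrightarrow> in_span Y \<Longrightarrow> in_span (\<lambda>\<omega>. X \<omega> - Y \<omega>)"
  using in_span_add[of X "\<lambda>\<omega>. (- 1) * Y \<omega>"] in_span_cmult[of Y "- 1"] by simp

lemma in_span_sum: "(\<And>i. i \<in> I \<Longrightarrow> in_span (X i)) \<Longrightarrow> in_span (\<lambda>\<omega>. \<Sum>i\<in>I. X i \<omega>)"
  by (induction I rule: infinite_finite_induct) (auto intro: in_span_zero in_span_add)

lemma in_span_gaussian: "in_span X \<Longrightarrow> gaussian_rv M X"
  using fbm unfolding in_span_def continuous_fBm_def gaussian_process_def by auto

lemma integrable_W:
  assumes "t \<in> {0..1}" shows "integrable M (W t)" "expectation (W t) = 0"
proof -
  show E: "expectation (W t) = 0" using fbm assms unfolding continuous_fBm_def by auto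
  have G: "gaussian_rv M (W t)" by (rule in_span_gaussian[OF in_span_W[OF assms]])
  have m: "W t \<in> borel_measurable M" using G unfolding gaussian_rv_def by (rule conjunct1)
  show "integrable M (W t)"
    by (rule square_integrable_imp_integrable[OF m centered_gaussian_rv(1)[OF G E]])
qed

lemma in_span_expectation:
  assumes "in_span X" shows "expectation X = 0"
proof -
  obtain J c where J: "finite J" "J \<subseteq> {0..1}" "X = (\<lambda>\<omega>. \<Sum>t\<in>J. c t * W t \<omega>)"
    using assms unfolding in_span_def by blast
  have "expectation X = (\<Sum>t\<in>J. c t * expectation (W t))"
    unfolding J(3) using integrable_W J(2) by (subst Bochner_Integration.integral_sum) auto
  also have "\<dots> = 0" using integrable_W J(2) by (intro sum.neutral) auto
  finally show ?thesis .
qed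

lemma in_span_square_integrable: "in_span X \<Longrightarrow> integrable M (\<lambda>\<omega>. (X \<omega>)\<^sup>2)"
  by (intro centered_gaussian_rv in_span_gaussian in_span_expectation)

lemma in_span_mult_integrable:
  assumes "in_span X" "in_span Y" shows "integrable M (\<lambda>\<omega>. X \<omega> * Y \<omega>)"
proof -
  have "integrable M (\<lambda>\<omega>. ((X \<omega> + Y \<omega>)\<^sup>2 - (X \<omega> - Y \<omega>)\<^sup>2) / 4)"
    using assms in_span_square_integrable in_span_add in_span_diff by auto
  then show ?thesis by (simp add: power2_eq_square algebra_simps)
qed

lemma expectation_W_mult:
  assumes "s \<in> {0..1}" "t \<in> {0..1}"
  shows "expectation (\<lambda>\<omega>. W s \<omega> * W t \<omega>) = (s powr (2 * H) + t powr (2 * H) - \<bar>t - s\<bar> powr (2 * H)) / 2"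
  using fbm assms unfolding continuous_fBm_def by auto

lemma expectation_increments_mult:
  assumes "x \<in> {0..1}" "x' \<in> {0..1}" "y \<in> {0..1}" "y' \<in> {0..1}"
  shows "expectation (\<lambda>\<omega>. (W x' \<omega> - W x \<omega>) * (W y' \<omega> - W y \<omega>))
    = (\<bar>y' - x\<bar> powr (2 * H) - \<bar>y - x\<bar> powr (2 * H) - \<bar>y' - x'\<bar> powr (2 * H) + \<bar>y - x'\<bar> powr (2 * H)) / 2"
proof -
  have i: "integrable M (\<lambda>\<omega>. W s \<omega> * W t \<omega>)" if "s \<in> {0..1}" "t \<in> {0..1}" for s t
    using that by (intro in_span_mult_integrable in_span_W)
  have "expectation (\<lambda>\<omega>. (W x' \<omega> - W x \<omega>) * (W y' \<omega> - W y \<omega>))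
    = expectation (\<lambda>\<omega>. W x' \<omega> * W y' \<omega> - W x' \<omega> * W y \<omega> - W x \<omega> * W y' \<omega> + W x \<omega> * W y \<omega>)"
    by (simp add: algebra_simps)
  also have "\<dots> = expectation (\<lambda>\<omega>. W x' \<omega> * W y' \<omega>) - expectation (\<lambda>\<omega>. W x' \<omega> * W y \<omega>)
      - expectation (\<lambda>\<omega>. W x \<omega> * W y' \<omega>) + expectation (\<lambda>\<omega>. W x \<omega> * W y \<omega>)"
    using i assms by simp
  finally show ?thesis unfolding expectation_W_mult[OF assms(2,4)] expectation_W_mult[OF assms(2,3)]
     expectation_W_mult[OF assms(1,4)] expectation_W_mult[OF assms(1,3)]
    by (simp add: add_divide_distrib diff_divide_distrib)
qed

definition cell_increment :: "nat \<Rightarrow> nat \<Rightarrow> 'a \<Rightarrow> real" where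
  "cell_increment i r \<omega> = mesh i powr (- H) * (W (real r * mesh i + mesh i) \<omega> - W (real r * mesh i) \<omega>)"

definition path_increment :: "nat \<Rightarrow> nat \<Rightarrow> 'a \<Rightarrow> real" where
  "path_increment n k \<omega> = (\<Sum>i\<in>{1..n}. cell_increment i (k mod b ^ i) \<omega>)"

lemma grid_points:
  assumes "r < b ^ i"
  shows "real r * mesh i \<in> {0..1}" "real r * mesh i + mesh i \<in> {0..1}"
proof -
  have "real r * mesh i + mesh i = real (Suc r) * mesh i" by (simp add: algebra_simps)
  also have "\<dots> \<le> real (b ^ i) * mesh i"
    using assms mesh_pos[of i] by (intro mult_right_mono of_nat_mono) auto
  finally have "real r * mesh i + mesh i \<le> 1" by (simp add: mesh_mult_power)
  then show "real r * mesh i \<in> {0..1}" "real r * mesh i + mesh i \<in> {0..1}"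
    using mesh_pos[of i] by auto
qed

lemma in_span_cell_increment: "r < b ^ i \<Longrightarrow> in_span (cell_increment i r)"
  unfolding cell_increment_def by (intro in_span_cmult in_span_diff in_span_W grid_points)

text \<open>The bridge from probability to the closed formula: four values of the covariance
  function combine, and the terms in a single time cancel.\<close>

lemma expectation_cell_increment_mult:
  assumes "r < b ^ i" "s < b ^ j"
  shows "expectation (\<lambda>\<omega>. cell_increment i r \<omega> * cell_increment j s \<omega>) = cell_cov i r j s"
proof -
  let ?a = "real r * mesh i" and ?y = "real s * mesh j" and ?l = "mesh i" and ?h = "mesh j"
  have "cell_increment i r \<omega> * cell_increment j s \<omega> = ?l powr (- H) * ?h powr (- H) *
      ((W (?a + ?l) \<omega> - W ?a \<omega>) * (W (?y + ?h) \<omega> - W ?y \<omega>))" for \<omega>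
    unfolding cell_increment_def by (simp only: mult_ac)
  then have "expectation (\<lambda>\<omega>. cell_increment i r \<omega> * cell_increment j s \<omega>) = ?l powr (- H) * ?h powr (- H) *
      expectation (\<lambda>\<omega>. (W (?a + ?l) \<omega> - W ?a \<omega>) * (W (?y + ?h) \<omega> - W ?y \<omega>))"
    by (simp only: integral_mult_right_zero)
  moreover have "?y + ?h - ?a = ?y - ?a + ?h" "?y + ?h - (?a + ?l) = ?y - ?a - ?l + ?h"
    "?y - (?a + ?l) = ?y - ?a - ?l" by simp_all
  moreover have "?l powr (- H) * ?h powr (- H) = (?l * ?h) powr (- H)"
    using mesh_pos[of i] mesh_pos[of j] by (simp add: powr_mult)
  moreover have aux: "p * ((x - y - z + w) / 2) = p * (x - y - (z - w)) / 2" for p x y z w :: real by simp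
  ultimately show ?thesis
    unfolding cell_cov_def power_increment_def
      expectation_increments_mult[OF grid_points[OF assms(1)] grid_points[OF assms(2)]]
    by (simp only: aux)
qed

lemma mod_power_less: "k mod b ^ i < b ^ i"
  using b_ge by simp

lemma in_span_path_increment: "in_span (path_increment n k)"
  unfolding path_increment_def by (rule in_span_sum, rule in_span_cell_increment, rule mod_power_less)

lemma expectation_path_increment_mult:
  "expectation (\<lambda>\<omega>. path_increment n k \<omega> * path_increment n l \<omega>) = path_cov n k l"
proof -
  have i: "integrable M (\<lambda>\<omega>. cell_increment i (k mod b ^ i) \<omega> * cell_increment j (l mod b ^ j) \<omega>)" for i j
    by (rule in_span_mult_integrable[OF in_span_cell_increment[OF mod_power_less] in_span_cell_increment[OF mod_power_less]])
  show ?thesis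
    unfolding path_increment_def path_cov_def sum_product
    using i by (simp only: Bochner_Integration.integral_sum Bochner_Integration.integrable_sum
        expectation_cell_increment_mult[OF mod_power_less mod_power_less])
qed

definition normalized_increment :: "real \<Rightarrow> nat \<Rightarrow> nat \<Rightarrow> 'a \<Rightarrow> real" where
  "normalized_increment \<theta> n k \<omega> = \<theta> / sqrt (real n) * path_increment n k \<omega>"

lemma in_span_normalized_increment: "in_span (normalized_increment \<theta> n k)"
  unfolding normalized_increment_def by (rule in_span_cmult, rule in_span_path_increment)

lemma expectation_normalized_increment_mult:
  "expectation (\<lambda>\<omega>. normalized_increment \<theta> n k \<omega> * normalized_increment \<theta> n l \<omega>) = \<theta>\<^sup>2 * path_cov n k l / real n"
proof -
  have "expectation (\<lambda>\<omega>. normalized_increment \<theta> n k \<omega> * normalized_increment \<theta> n l \<omega>)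
     = (\<theta> / sqrt (real n))\<^sup>2 * expectation (\<lambda>\<omega>. path_increment n k \<omega> * path_increment n l \<omega>)"
  proof -
    have "normalized_increment \<theta> n k \<omega> * normalized_increment \<theta> n l \<omega>
        = (\<theta> / sqrt (real n))\<^sup>2 * (path_increment n k \<omega> * path_increment n l \<omega>)" for \<omega>
      unfolding normalized_increment_def power2_eq_square by (simp only: mult_ac)
    then show ?thesis by (simp only: integral_mult_right_zero)
  qed
  then show ?thesis by (simp add: expectation_path_increment_mult power_divide)
qed

end

section \<open>Almost sure convergence of the averages\<close>

context fbm_grid
begin

lemma in_span_second_moments:
  assumes "in_span X" "in_span Y"
  shows "expectation (\<lambda>\<omega>. (X \<omega> + Y \<omega>)\<^sup>2)
      = expectation (\<lambda>\<omega>. X \<omega> * X \<omega>) + 2 * expectation (\<lambda>\<omega>. X \<omega> * Y \<omega>) + expectation (\<lambda>\<omega>. Y \<omega> * Y \<omega>)"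
    and "expectation (\<lambda>\<omega>. (X \<omega> - Y \<omega>)\<^sup>2)
      = expectation (\<lambda>\<omega>. X \<omega> * X \<omega>) - 2 * expectation (\<lambda>\<omega>. X \<omega> * Y \<omega>) + expectation (\<lambda>\<omega>. Y \<omega> * Y \<omega>)"
proof -
  note i = in_span_mult_integrable[OF assms] in_span_mult_integrable[OF assms(1,1)] in_span_mult_integrable[OF assms(2,2)]
  have "(\<lambda>\<omega>. (X \<omega> + Y \<omega>)\<^sup>2) = (\<lambda>\<omega>. X \<omega> * X \<omega> + 2 * (X \<omega> * Y \<omega>) + Y \<omega> * Y \<omega>)"
    "(\<lambda>\<omega>. (X \<omega> - Y \<omega>)\<^sup>2) = (\<lambda>\<omega>. X \<omega> * X \<omega> - 2 * (X \<omega> * Y \<omega>) + Y \<omega> * Y \<omega>)"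
    by (auto simp: power2_eq_square algebra_simps)
  then show "expectation (\<lambda>\<omega>. (X \<omega> + Y \<omega>)\<^sup>2)
      = expectation (\<lambda>\<omega>. X \<omega> * X \<omega>) + 2 * expectation (\<lambda>\<omega>. X \<omega> * Y \<omega>) + expectation (\<lambda>\<omega>. Y \<omega> * Y \<omega>)"
    and "expectation (\<lambda>\<omega>. (X \<omega> - Y \<omega>)\<^sup>2)
      = expectation (\<lambda>\<omega>. X \<omega> * X \<omega>) - 2 * expectation (\<lambda>\<omega>. X \<omega> * Y \<omega>) + expectation (\<lambda>\<omega>. Y \<omega> * Y \<omega>)"
    using i by simp_all
qed

lemma in_span_even_transform:
  assumes "in_span X" "f = cos \<and> e = - 1 \<or> f = cosh \<and> e = 1"
  shows "integrable M (\<lambda>\<omega>. f (X \<omega>))"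
    and "expectation (\<lambda>\<omega>. f (X \<omega>)) = exp (e * expectation (\<lambda>\<omega>. (X \<omega>)\<^sup>2) / 2)"
proof -
  note G = in_span_gaussian[OF assms(1)] in_span_expectation[OF assms(1)]
  have [measurable]: "X \<in> borel_measurable M" using G(1) by (simp add: gaussian_rv_def)
  have "integrable M (\<lambda>\<omega>. cos (X \<omega>))" by (intro integrable_const_bound[of _ 1]) auto
  then show "integrable M (\<lambda>\<omega>. f (X \<omega>))" using assms(2) centered_gaussian_rv(2)[OF G] by auto
  show "expectation (\<lambda>\<omega>. f (X \<omega>)) = exp (e * expectation (\<lambda>\<omega>. (X \<omega>)\<^sup>2) / 2)"
    using assms(2) centered_gaussian_rv(3,4)[OF G] by auto
qed

text \<open>The difference splits into a fluctuation around the exact means and a deterministic bias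
  of these means. The first has second moment of order 1 / n^2, the second is of order 1 / n.
  Partial ranges N n \<le> b^n are allowed because the bounding sums have nonnegative terms and can
  be extended to all b^n indices.\<close>

lemma AE_normalized_average_tendsto:
  assumes f: "f = cos \<and> e = - 1 \<or> f = cosh \<and> e = 1" and N: "\<And>n. N n \<le> b ^ n"
  shows "AE \<omega> in M. (\<lambda>n. (\<Sum>k<N n. f (normalized_increment \<theta> n k \<omega>) - exp (e * \<theta>\<^sup>2 / 2)) / real b ^ n) \<longlonglongrightarrow> 0"
proof -
  \<comment> \<open>A common bound for the normalised covariances and, thanks to the summand 1, for
    \<theta>^2 as well; both exponents must lie in the range where exp has Lipschitz constant exp
    C.\<close>
  define C where "C = \<theta>\<^sup>2 * (4 / (1 - rate) + 1)"
  define v where "v n k l = \<theta>\<^sup>2 * path_cov n k l / real n" for n k l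
  let ?a = "\<lambda>n k. exp (e * v n k k / 2)"
  let ?Z = "\<lambda>n k. normalized_increment \<theta> n k"
  have e: "\<bar>e\<bar> = 1" using f by auto
  have ff: "f x * f y = (f (x + y) + f (x - y)) / 2" for x y
    using f by (auto simp: cos_times_cos cosh_add cosh_diff)
  have "0 \<le> 4 / (1 - rate)" using rate_bounds by auto
  then have C0: "\<theta>\<^sup>2 \<le> C" "0 \<le> C" by (auto simp: C_def distrib_left)
  have vC: "\<bar>v n k l\<bar> \<le> C" for n k l
  proof (cases "n = 0")
    case False
    have "\<bar>v n k l\<bar> = \<theta>\<^sup>2 * (\<bar>path_cov n k l\<bar> / real n)" by (simp add: v_def abs_mult)
    also have "\<dots> \<le> \<theta>\<^sup>2 * (4 / (1 - rate) + 1)"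
      using abs_path_cov_le[of n k l] False by (intro mult_left_mono) (auto simp: pos_divide_le_eq distrib_right)
    finally show ?thesis by (simp add: C_def)
  qed (use C0 in \<open>simp add: v_def\<close>)
  note span = in_span_normalized_increment
  have tr: "integrable M (\<lambda>\<omega>. f (?Z n k \<omega> + ?Z n l \<omega>))" "integrable M (\<lambda>\<omega>. f (?Z n k \<omega> - ?Z n l \<omega>))"
    "integrable M (\<lambda>\<omega>. f (?Z n k \<omega>))"
    "expectation (\<lambda>\<omega>. f (?Z n k \<omega>)) = ?a n k"
    "expectation (\<lambda>\<omega>. f (?Z n k \<omega> + ?Z n l \<omega>)) = exp (e * (v n k k + 2 * v n k l + v n l l) / 2)"
    "expectation (\<lambda>\<omega>. f (?Z n k \<omega> - ?Z n l \<omega>)) = exp (e * (v n k k - 2 * v n k l + v n l l) / 2)" for n k l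
    using in_span_even_transform[OF in_span_add[OF span span] f, of \<theta> n k \<theta> n l]
      in_span_even_transform[OF in_span_diff[OF span span] f, of \<theta> n k \<theta> n l]
      in_span_even_transform[OF span f, of \<theta> n k]
      in_span_second_moments[OF span span, of \<theta> n k \<theta> n l]
      expectation_normalized_increment_mult[of \<theta> n]
    by (simp_all add: v_def power2_eq_square)
  \<comment> \<open>The fluctuation. At n = 0 division by zero makes the increments and
    \<open>v 0\<close> vanish, so the moment bound also holds there, as 0 \<le> 0.\<close>
  define X where "X n \<omega> = (\<Sum>k<N n. f (?Z n k \<omega>) - ?a n k) / real b ^ n" for n \<omega>
  define K where "K = exp C * (cosh C)\<^sup>2"
  have K: "0 \<le> K" by (simp add: K_def)
  define L where "L = 48 * (1 / (1 - root_rate)) ^ 4"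
  have moment: "integrable M (\<lambda>\<omega>. (X n \<omega>)\<^sup>2)"
     "expectation (\<lambda>\<omega>. (X n \<omega>)\<^sup>2) \<le> K * \<theta>^4 * L * (1 / (real n)\<^sup>2)" for n
  proof -
    note S = second_moment_centered_sum[where f = f and Z = "?Z n" and v = "v n" and e = e and C = C and N = "N n",
        OF ff tr(1-3)[of n] tr(4)[of n] tr(5,6)[of n] e vC]
    show "integrable M (\<lambda>\<omega>. (X n \<omega>)\<^sup>2)" unfolding X_def power_divide using S(1) by auto
    have "expectation (\<lambda>\<omega>. (X n \<omega>)\<^sup>2) = expectation (\<lambda>\<omega>. (\<Sum>k<N n. f (?Z n k \<omega>) - ?a n k)\<^sup>2) / (real b ^ n)\<^sup>2"
      unfolding X_def power_divide by simp
    also have "\<dots> \<le> K * (\<Sum>k<N n. \<Sum>l<N n. (v n k l)\<^sup>2) / (real b ^ n)\<^sup>2"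
      using S(2) by (intro divide_right_mono) (auto simp: K_def)
    also have "\<dots> \<le> K * (\<Sum>k<b ^ n. \<Sum>l<b ^ n. (v n k l)\<^sup>2) / (real b ^ n)\<^sup>2"
    proof (intro divide_right_mono mult_left_mono K)
      have "(\<Sum>k<N n. \<Sum>l<N n. (v n k l)\<^sup>2) \<le> (\<Sum>k<N n. \<Sum>l<b ^ n. (v n k l)\<^sup>2)"
        using N[of n] by (intro sum_mono sum_mono2) auto
      also have "\<dots> \<le> (\<Sum>k<b ^ n. \<Sum>l<b ^ n. (v n k l)\<^sup>2)"
        using N[of n] by (intro sum_mono2 sum_nonneg) auto
      finally show "(\<Sum>k<N n. \<Sum>l<N n. (v n k l)\<^sup>2) \<le> (\<Sum>k<b ^ n. \<Sum>l<b ^ n. (v n k l)\<^sup>2)" .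
    qed simp
    also have "(\<Sum>k<b ^ n. \<Sum>l<b ^ n. (v n k l)\<^sup>2) = \<theta>^4 / (real n)\<^sup>2 * (\<Sum>k<b ^ n. \<Sum>l<b ^ n. (path_cov n k l)\<^sup>2)"
      by (simp add: v_def power_mult_distrib power_divide sum_distrib_left flip: power_mult)
    also have "K * (\<theta>^4 / (real n)\<^sup>2 * (\<Sum>k<b ^ n. \<Sum>l<b ^ n. (path_cov n k l)\<^sup>2)) / (real b ^ n)\<^sup>2
        \<le> K * (\<theta>^4 / (real n)\<^sup>2 * (L * (real b ^ n)\<^sup>2)) / (real b ^ n)\<^sup>2"
      unfolding L_def using K by (intro divide_right_mono mult_left_mono sum_path_cov_square_le) auto
    also have "\<dots> = K * \<theta>^4 * L * (1 / (real n)\<^sup>2)" using b_ge by simp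
    finally show "expectation (\<lambda>\<omega>. (X n \<omega>)\<^sup>2) \<le> K * \<theta>^4 * L * (1 / (real n)\<^sup>2)" .
  qed
  have "summable (\<lambda>n. expectation (\<lambda>\<omega>. (X n \<omega>)\<^sup>2))"
  proof (rule summable_comparison_test')
    show "summable (\<lambda>n. K * \<theta>^4 * L * (1 / (real n)\<^sup>2))"
      using inverse_power_summable[of 2, where 'a = real] by (intro summable_mult) (simp add: inverse_eq_divide)
    show "norm (expectation (\<lambda>\<omega>. (X n \<omega>)\<^sup>2)) \<le> K * \<theta>^4 * L * (1 / (real n)\<^sup>2)" if "0 \<le> n" for n
      using moment(2)[of n] by (simp add: Bochner_Integration.integral_nonneg)
  qed
  then have AE: "AE \<omega> in M. (\<lambda>n. X n \<omega>) \<longlonglongrightarrow> 0"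
    by (intro AE_tendsto_0_of_summable_second_moments moment)
  \<comment> \<open>The bias: the exact means differ from the limit only through the deviation of
    \<open>path_cov n k k\<close> from n, which is bounded on average.\<close>
  define D where "D n = (\<Sum>k<N n. ?a n k - exp (e * \<theta>\<^sup>2 / 2)) / real b ^ n" for n
  have D: "D \<longlonglongrightarrow> 0"
  proof (rule Lim_null_comparison)
    define c where "c = exp C * \<theta>\<^sup>2 * (24 * (1 / (1 - root_rate))\<^sup>2)"
    show "(\<lambda>n. c * (1 / real n)) \<longlonglongrightarrow> 0" by (intro tendsto_mult_right_zero lim_1_over_n)
    have "norm (D n) \<le> c * (1 / real n)" if n: "1 \<le> n" for n
    proof -
      have "\<bar>?a n k - exp (e * \<theta>\<^sup>2 / 2)\<bar> \<le> exp C * (\<theta>\<^sup>2 / real n * \<bar>path_cov n k k - real n\<bar>)" for k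
      proof -
        have "\<bar>?a n k - exp (e * \<theta>\<^sup>2 / 2)\<bar> \<le> exp C * \<bar>e * v n k k / 2 - e * \<theta>\<^sup>2 / 2\<bar>"
          using vC[of n k k] e C0 by (intro abs_exp_diff_le) (auto simp: abs_mult)
        also have "e * v n k k / 2 - e * \<theta>\<^sup>2 / 2 = e * (\<theta>\<^sup>2 / real n * (path_cov n k k - real n)) / 2"
          using n by (simp add: v_def field_simps)
        also have "\<bar>e * (\<theta>\<^sup>2 / real n * (path_cov n k k - real n)) / 2\<bar>
            = \<theta>\<^sup>2 / real n * \<bar>path_cov n k k - real n\<bar> / 2"
          using e by (simp add: abs_mult)
        also have "exp C * \<dots> \<le> exp C * (\<theta>\<^sup>2 / real n * \<bar>path_cov n k k - real n\<bar>)"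
        proof (rule mult_left_mono)
          have half: "w / 2 \<le> w" if "0 \<le> w" for w :: real using that by simp
          show "\<theta>\<^sup>2 / real n * \<bar>path_cov n k k - real n\<bar> / 2 \<le> \<theta>\<^sup>2 / real n * \<bar>path_cov n k k - real n\<bar>"
            by (rule half) simp
        qed simp
        finally show ?thesis .
      qed
      then have "\<bar>\<Sum>k<N n. ?a n k - exp (e * \<theta>\<^sup>2 / 2)\<bar> \<le> (\<Sum>k<N n. exp C * (\<theta>\<^sup>2 / real n * \<bar>path_cov n k k - real n\<bar>))"
        by (intro order.trans[OF sum_abs] sum_mono)
      also have "\<dots> \<le> (\<Sum>k<b ^ n. exp C * (\<theta>\<^sup>2 / real n * \<bar>path_cov n k k - real n\<bar>))"
        using N[of n] by (intro sum_mono2) auto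
      also have "\<dots> = exp C * (\<theta>\<^sup>2 / real n) * (\<Sum>k<b ^ n. \<bar>path_cov n k k - real n\<bar>)"
        by (simp add: sum_distrib_left mult.assoc)
      also have "\<dots> \<le> exp C * (\<theta>\<^sup>2 / real n) * (24 * (1 / (1 - root_rate))\<^sup>2 * real b ^ n)"
        by (intro mult_left_mono sum_abs_path_cov_diag_le) auto
      finally have le: "\<bar>\<Sum>k<N n. ?a n k - exp (e * \<theta>\<^sup>2 / 2)\<bar>
          \<le> exp C * (\<theta>\<^sup>2 / real n) * (24 * (1 / (1 - root_rate))\<^sup>2 * real b ^ n)" .
      have "norm (D n) = \<bar>\<Sum>k<N n. ?a n k - exp (e * \<theta>\<^sup>2 / 2)\<bar> / real b ^ n"
        by (simp add: D_def abs_divide)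
      also have "\<dots> \<le> exp C * (\<theta>\<^sup>2 / real n) * (24 * (1 / (1 - root_rate))\<^sup>2 * real b ^ n) / real b ^ n"
        by (rule divide_right_mono[OF le]) simp
      also have "\<dots> = c * (1 / real n)" using b_ge by (simp add: c_def)
      finally show ?thesis .
    qed
    then show "\<forall>\<^sub>F n in sequentially. norm (D n) \<le> c * (1 / real n)"
      unfolding eventually_sequentially by blast
  qed
  from AE show ?thesis
  proof eventually_elim
    case (elim \<omega>)
    have "(\<lambda>n. X n \<omega> + D n) \<longlonglongrightarrow> 0 + 0" by (intro tendsto_add elim D)
    moreover have "X n \<omega> + D n = (\<Sum>k<N n. f (?Z n k \<omega>) - exp (e * \<theta>\<^sup>2 / 2)) / real b ^ n" for n
      unfolding X_def D_def add_divide_distrib[symmetric] sum.distrib[symmetric] by simp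
    ultimately show ?case by simp
  qed
qed

end

section \<open>Uniform perturbations and passage to all times\<close>

lemma cosh_add_le: "cosh (x + y) \<le> cosh x * exp \<bar>y\<bar>" for x y :: real
proof -
  have "exp (x + y) \<le> exp x * exp \<bar>y\<bar>" "exp (- (x + y)) \<le> exp (- x) * exp \<bar>y\<bar>"
    unfolding exp_add[symmetric] by auto
  then show ?thesis by (simp add: cosh_field_def distrib_right add_divide_distrib)
qed

text \<open>Here z is the Gaussian array, x differs from it by the contribution of \<kappa>, and B n
  is the number of all cells while N n counts those before time t. Division by N n instead of B n
  yields genuine averages and produces the factor t. A uniformly small perturbation changes cosines
  little and cosh by a bounded factor.\<close>

lemma perturbed_moment_tendsto:
  fixes x z :: "nat \<Rightarrow> nat \<Rightarrow> real" and N :: "nat \<Rightarrow> nat" and B \<epsilon> :: "nat \<Rightarrow> real"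
  assumes q: "0 < q" and t: "0 < t" and B: "\<And>n. 0 < B n" and N: "(\<lambda>n. real (N n) / B n) \<longlonglongrightarrow> t"
    and cos: "\<And>\<theta>. \<theta> \<in> \<rat> \<Longrightarrow> (\<lambda>n. (\<Sum>k<N n. cos (\<theta> * z n k) - exp (- \<theta>\<^sup>2 / 2)) / B n) \<longlonglongrightarrow> 0"
    and cosh: "(\<lambda>n. (\<Sum>k<N n. cosh (z n k) - exp (1 / 2)) / B n) \<longlonglongrightarrow> 0"
    and x: "\<And>n k. k < N n \<Longrightarrow> \<bar>x n k - z n k\<bar> \<le> \<epsilon> n" and \<epsilon>: "\<epsilon> \<longlonglongrightarrow> 0"
  shows "(\<lambda>n. (\<Sum>k<N n. \<bar>x n k\<bar> powr q) / B n) \<longlonglongrightarrow> t * (LINT y|std_normal_distribution. \<bar>y\<bar> powr q)"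
proof -
  have "\<forall>\<^sub>F n in sequentially. 0 < real (N n) / B n" using order_tendstoD(1)[OF N t] .
  then have "\<forall>\<^sub>F n in sequentially. 0 < N n"
    by eventually_elim (auto simp: zero_less_divide_iff)
  then obtain n0 where n0: "\<And>n. n0 \<le> n \<Longrightarrow> 0 < N n"
    unfolding eventually_sequentially by blast
  \<comment> \<open>For small n there may be no complete cell before t; the shift makes all counts
    positive, as empirical distributions require.\<close>
  define N' where "N' n = N (n + n0)" for n
  have N': "0 < N' n" for n using n0 by (simp add: N'_def)
  let ?avg = "\<lambda>f y n. (\<Sum>k<N' n. f (y (n + n0) k)) / real (N' n) :: real"
  have ratio: "(\<lambda>n. real (N' n) / B (n + n0)) \<longlonglongrightarrow> t"
    unfolding N'_def by (rule LIMSEQ_ignore_initial_segment[OF N])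
  have avg: "(\<lambda>n. ?avg f z n) \<longlonglongrightarrow> a"
    if "(\<lambda>n. (\<Sum>k<N n. f (z n k) - a) / B n) \<longlonglongrightarrow> 0" for f :: "real \<Rightarrow> real" and a
  proof -
    have "(\<lambda>n. (\<Sum>k<N' n. f (z (n + n0) k) - a) / B (n + n0)) \<longlonglongrightarrow> 0"
      unfolding N'_def by (rule LIMSEQ_ignore_initial_segment[OF that])
    from tendsto_divide[OF this ratio] t
    have "(\<lambda>n. (\<Sum>k<N' n. f (z (n + n0) k) - a) / B (n + n0) / (real (N' n) / B (n + n0)) + a) \<longlonglongrightarrow> 0 / t + a"
      by (intro tendsto_add tendsto_const) auto
    moreover have "(\<Sum>k<N' n. f (z (n + n0) k) - a) / B (n + n0) / (real (N' n) / B (n + n0)) + a = ?avg f z n" for n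
      using N'[of n] B[of "n + n0"] by (simp add: sum_subtractf field_simps)
    ultimately show ?thesis by simp
  qed
  have cosx: "(\<lambda>n. ?avg (\<lambda>y. cos (\<theta> * y)) x n) \<longlonglongrightarrow> exp (- \<theta>\<^sup>2 / 2)" if \<theta>: "\<theta> \<in> \<rat>" for \<theta>
  proof -
    have d: "norm (?avg (\<lambda>y. cos (\<theta> * y)) x n - ?avg (\<lambda>y. cos (\<theta> * y)) z n) \<le> \<bar>\<theta>\<bar> * \<epsilon> (n + n0)" for n
    proof -
      have "\<bar>cos (\<theta> * x (n + n0) k) - cos (\<theta> * z (n + n0) k)\<bar> \<le> \<bar>\<theta>\<bar> * \<epsilon> (n + n0)" if "k < N' n" for k
      proof -
        have "\<bar>cos (\<theta> * x (n + n0) k) - cos (\<theta> * z (n + n0) k)\<bar> \<le> \<bar>\<theta> * x (n + n0) k - \<theta> * z (n + n0) k\<bar>"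
          by (rule abs_cos_diff_le)
        also have "\<dots> = \<bar>\<theta>\<bar> * \<bar>x (n + n0) k - z (n + n0) k\<bar>" by (simp flip: abs_mult right_diff_distrib)
        also have "\<dots> \<le> \<bar>\<theta>\<bar> * \<epsilon> (n + n0)" using that by (intro mult_left_mono x) (auto simp: N'_def)
        finally show ?thesis .
      qed
      then have "\<bar>\<Sum>k<N' n. cos (\<theta> * x (n + n0) k) - cos (\<theta> * z (n + n0) k)\<bar> \<le> (\<Sum>k<N' n. \<bar>\<theta>\<bar> * \<epsilon> (n + n0))"
        by (intro order.trans[OF sum_abs] sum_mono) auto
      then show ?thesis
        using N'[of n] by (simp add: sum_subtractf abs_divide field_simps flip: diff_divide_distrib)
    qed
    have e0: "(\<lambda>n. \<bar>\<theta>\<bar> * \<epsilon> (n + n0)) \<longlonglongrightarrow> 0"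
      by (rule tendsto_mult_right_zero, rule LIMSEQ_ignore_initial_segment[OF \<epsilon>])
    have "(\<lambda>n. ?avg (\<lambda>y. cos (\<theta> * y)) x n - ?avg (\<lambda>y. cos (\<theta> * y)) z n) \<longlonglongrightarrow> 0"
      by (rule Lim_null_comparison[OF always_eventually e0], rule allI, rule d)
    from tendsto_add[OF this avg[OF cos[OF \<theta>]]] show ?thesis by simp
  qed
  have above: "\<exists>c. \<forall>n. X n \<le> c" if "X \<longlonglongrightarrow> l" for X :: "nat \<Rightarrow> real" and l
    using Bseq_bdd_above[OF convergent_imp_Bseq[OF convergentI[OF that]]] by (auto simp: bdd_above_def)
  obtain b1 where b1: "\<And>n. ?avg cosh z n \<le> b1"
    using above[OF avg[OF cosh]] by blast
  obtain b2 where b2: "\<And>n. \<epsilon> n \<le> b2"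
    using above[OF \<epsilon>] by blast
  have coshx: "?avg cosh x n \<le> b1 * exp b2" for n
  proof -
    have "(\<Sum>k<N' n. cosh (x (n + n0) k)) \<le> (\<Sum>k<N' n. cosh (z (n + n0) k) * exp b2)"
    proof (intro sum_mono)
      fix k assume "k \<in> {..<N' n}"
      then have "\<bar>x (n + n0) k - z (n + n0) k\<bar> \<le> b2" using x[of k "n + n0"] b2[of "n + n0"] by (simp add: N'_def)
      then have le: "cosh (z (n + n0) k) * exp \<bar>x (n + n0) k - z (n + n0) k\<bar> \<le> cosh (z (n + n0) k) * exp b2"
        by (intro mult_left_mono) auto
      have "cosh (x (n + n0) k) \<le> cosh (z (n + n0) k) * exp \<bar>x (n + n0) k - z (n + n0) k\<bar>"
        using cosh_add_le[of "z (n + n0) k" "x (n + n0) k - z (n + n0) k"] by simp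
      from this le show "cosh (x (n + n0) k) \<le> cosh (z (n + n0) k) * exp b2" by (rule order.trans)
    qed
    then have "?avg cosh x n \<le> ?avg cosh z n * exp b2"
      by (simp add: sum_distrib_right divide_right_mono)
    also have "\<dots> \<le> b1 * exp b2" by (intro mult_right_mono b1) auto
    finally show ?thesis .
  qed
  have "(\<lambda>n. ?avg (\<lambda>y. \<bar>y\<bar> powr q) x n) \<longlonglongrightarrow> (LINT y|std_normal_distribution. \<bar>y\<bar> powr q)"
    by (rule empirical_moment_tendsto[OF N' q cosx coshx])
  note lim = tendsto_mult[OF ratio this]
  have "(\<lambda>n. (\<Sum>k<N (n + n0). \<bar>x (n + n0) k\<bar> powr q) / B (n + n0)) \<longlonglongrightarrow> t * (LINT y|std_normal_distribution. \<bar>y\<bar> powr q)"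
  proof -
    have "real (N' n) / B (n + n0) * ?avg (\<lambda>y. \<bar>y\<bar> powr q) x n
        = (\<Sum>k<N (n + n0). \<bar>x (n + n0) k\<bar> powr q) / B (n + n0)" for n
      using N'[of n] by (simp add: N'_def)
    with lim show ?thesis by (simp only:)
  qed
  then show ?thesis by (rule LIMSEQ_offset)
qed

text \<open>Rational times just below and above t squeeze the value at t, since the limit is
  continuous in time. Only countably many exceptional null sets have to be united.\<close>

lemma tendsto_linear_of_mono_Rats:
  fixes F :: "nat \<Rightarrow> real \<Rightarrow> real"
  assumes conv: "\<And>r. r \<in> \<rat> \<Longrightarrow> 0 \<le> r \<Longrightarrow> r \<le> 1 \<Longrightarrow> (\<lambda>n. F n r) \<longlonglongrightarrow> r * c"
    and mono: "\<And>n x y. x \<le> y \<Longrightarrow> F n x \<le> F n y" and t: "0 \<le> t" "t \<le> 1"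
  shows "(\<lambda>n. F n t) \<longlonglongrightarrow> t * c"
proof (cases "t \<in> \<rat>")
  case False
  then have t': "0 < t" "t < 1" using t by (auto simp: less_le)
  have c: "0 \<le> c"
  proof -
    have "(\<lambda>n. F n 0) \<longlonglongrightarrow> 0 * c" "(\<lambda>n. F n 1) \<longlonglongrightarrow> 1 * c" by (intro conv; simp)+
    then have "0 * c \<le> 1 * c" by (rule LIMSEQ_le) (intro exI allI impI mono, simp)
    then show ?thesis by simp
  qed
  show ?thesis
  proof (rule LIMSEQ_I)
    fix e :: real assume e: "0 < e"
    define d where "d = e / (2 * (c + 1))"
    have d: "0 < d" using e c by (simp add: d_def)
    have dc: "d * c \<le> e / 2"
    proof -
      have "d * c \<le> d * (c + 1)" using d by (intro mult_left_mono) auto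
      also have "\<dots> = e / 2" using nonzero_mult_divide_mult_cancel_right[of "c + 1" e 2] c by (simp add: d_def)
      finally show ?thesis .
    qed
    obtain r where r: "r \<in> \<rat>" "max 0 (t - d) < r" "r < t" using Rats_dense_in_real[of "max 0 (t - d)" t] t' d by auto
    obtain s where s: "s \<in> \<rat>" "t < s" "s < min 1 (t + d)" using Rats_dense_in_real[of t "min 1 (t + d)"] t' d by auto
    obtain n1 where n1: "\<And>n. n1 \<le> n \<Longrightarrow> \<bar>F n r - r * c\<bar> < e / 2"
      using LIMSEQ_D[OF conv[OF r(1)], of "e / 2"] r t' e by auto
    obtain n2 where n2: "\<And>n. n2 \<le> n \<Longrightarrow> \<bar>F n s - s * c\<bar> < e / 2"
      using LIMSEQ_D[OF conv[OF s(1)], of "e / 2"] s t' e by auto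
    have "t * c - r * c \<le> e / 2"
    proof -
      have "(t - r) * c \<le> d * c" using r c by (intro mult_right_mono) auto
      then show ?thesis using dc by (simp add: algebra_simps)
    qed
    moreover have "s * c - t * c \<le> e / 2"
    proof -
      have "(s - t) * c \<le> d * c" using s c by (intro mult_right_mono) auto
      then show ?thesis using dc by (simp add: algebra_simps)
    qed
    ultimately have "\<bar>F n t - t * c\<bar> < e" if "max n1 n2 \<le> n" for n
      using n1[of n] n2[of n] that mono[of r t n] mono[of t s n] r(3) s(2)
      unfolding abs_less_iff by (simp add: algebra_simps)
    then show "\<exists>no. \<forall>n\<ge>no. norm (F n t - t * c) < e"
      by (intro exI[of _ "max n1 n2"]) simp
  qed
qed (use conv t in auto)

section \<open>Increments of the Wiener-Weierstrass bridge\<close>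

locale wiener_weierstrass_bridge = fbm_grid M H b W
  for M :: "'a measure" and H :: real and b :: nat and W +
  fixes \<kappa> :: "real \<Rightarrow> real" and \<tau> \<alpha> :: real
  assumes kappa_0: "\<kappa> 0 = 0" and kappa_1: "\<kappa> 1 = 1"
    and tau: "H < \<tau>" and holder: "holder_on \<tau> {0..1} \<kappa>"
    and alpha: "\<alpha> = real b powr (- H)"
begin

abbreviation Y :: "real \<Rightarrow> 'a \<Rightarrow> real" where
  "Y \<equiv> wiener_weierstrass \<alpha> b (bridge \<kappa> W)"

text \<open>The normalised increments of \<kappa>, summed over the levels: the coefficient of W 1
  that separates the bridge from W.\<close>

definition drift :: "nat \<Rightarrow> nat \<Rightarrow> real" where
  "drift n k = (\<Sum>i\<in>{1..n}. mesh i powr (- H) *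
     (\<kappa> (real (k mod b ^ i) * mesh i + mesh i) - \<kappa> (real (k mod b ^ i) * mesh i)))"

text \<open>The covariance gives W 0 variance 0, hence only almost sure vanishing. The path
  identities below assume it for the given sample point.\<close>

lemma AE_W_0: "AE \<omega> in M. W 0 \<omega> = 0"
proof -
  have "expectation (\<lambda>\<omega>. (W 0 \<omega>)\<^sup>2) = 0"
    using expectation_W_mult[of 0 0] H_pos by (simp add: power2_eq_square)
  moreover have "integrable M (\<lambda>\<omega>. (W 0 \<omega>)\<^sup>2)"
    by (rule in_span_square_integrable, rule in_span_W) simp
  ultimately have "AE \<omega> in M. (W 0 \<omega>)\<^sup>2 = 0"
    by (subst (asm) integral_nonneg_eq_0_iff_AE) auto
  then show ?thesis by eventually_elim simp
qed

lemma drift_bounded: "\<exists>c\<ge>0. \<forall>n k. \<bar>drift n k\<bar> \<le> c"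
proof -
  obtain C where C: "\<And>x y. x \<in> {0..1} \<Longrightarrow> y \<in> {0..1} \<Longrightarrow> \<bar>\<kappa> x - \<kappa> y\<bar> \<le> C * \<bar>x - y\<bar> powr \<tau>"
    using holder unfolding holder_on_def by blast
  \<comment> \<open>Holder continuity gives terms of size b^(-i\<tau>) against the normalisation
    b^(iH); their ratio is geometric because \<tau> > H.\<close>
  define \<rho> where "\<rho> = real b powr (H - \<tau>)"
  have \<rho>: "0 < \<rho>" "\<rho> < 1" using b_ge tau by (auto simp: \<rho>_def powr_less_one)
  have C0: "0 \<le> C" using order.trans[OF abs_ge_zero C[of 0 1]] by simp
  have "\<bar>drift n k\<bar> \<le> C * (1 / (1 - \<rho>))" for n k
  proof -
    have "\<bar>drift n k\<bar> \<le> (\<Sum>i\<in>{1..n}. C * \<rho> ^ i)"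
      unfolding drift_def
    proof (intro order.trans[OF sum_abs] sum_mono)
      fix i
      let ?r = "real (k mod b ^ i) * mesh i"
      have "\<bar>\<kappa> (?r + mesh i) - \<kappa> ?r\<bar> \<le> C * mesh i powr \<tau>"
        using C[OF grid_points(2,1)[OF mod_power_less[of k i]]] mesh_pos[of i] by simp
      then have "mesh i powr (- H) * \<bar>\<kappa> (?r + mesh i) - \<kappa> ?r\<bar> \<le> mesh i powr (- H) * (C * mesh i powr \<tau>)"
        by (rule mult_left_mono) simp
      also have "\<dots> = C * mesh i powr (\<tau> - H)" by (simp add: powr_diff powr_minus field_simps)
      also have "mesh i powr (\<tau> - H) = \<rho> ^ i"
        using b_ge by (simp add: \<rho>_def mesh_powr powr_power algebra_simps)
      finally show "\<bar>mesh i powr (- H) * (\<kappa> (?r + mesh i) - \<kappa> ?r)\<bar> \<le> C * \<rho> ^ i"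
        by (simp add: abs_mult)
    qed
    also have "\<dots> \<le> C * (1 / (1 - \<rho>))"
      unfolding sum_distrib_left[symmetric] using \<rho> C0
      by (intro mult_left_mono sum_power_le_geometric) auto
    finally show ?thesis .
  qed
  moreover have "0 \<le> C * (1 / (1 - \<rho>))" using C0 \<rho> by simp
  ultimately show ?thesis by blast
qed

lemma frac_mesh: "frac (real k * mesh i) = real (k mod b ^ i) * mesh i"
proof -
  have "real k * mesh i = of_int (int (k div b ^ i)) + real (k mod b ^ i) * mesh i"
  proof -
    have "real k = real (k div b ^ i) * real b ^ i + real (k mod b ^ i)"
      by (simp only: of_nat_add[symmetric] of_nat_mult[symmetric] of_nat_power[symmetric] div_mult_mod_eq)
    then have "real k * mesh i = (real (k div b ^ i) * real b ^ i + real (k mod b ^ i)) * mesh i"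
      by (rule arg_cong)
    also have "\<dots> = real (k div b ^ i) * (real b ^ i * mesh i) + real (k mod b ^ i) * mesh i"
      by (simp only: distrib_right mult.assoc)
    finally show ?thesis by (simp add: mesh_mult_power)
  qed
  moreover have "0 \<le> real (k mod b ^ i) * mesh i" "real (k mod b ^ i) * mesh i < 1"
    using grid_points(2)[OF mod_power_less[of k i]] mesh_pos[of i] by auto
  ultimately show ?thesis by (subst frac_unique_iff) auto
qed

text \<open>At a b-adic point of level n the argument b^m t is an integer for m \<ge> n, and the
  bridge vanishes at 0, so n terms of the series remain. The substitution i = n - m indexes them by
  the level of the point reached.\<close>

lemma Y_mesh:
  assumes "W 0 \<omega> = 0"
  shows "Y (real k * mesh n) \<omega> = (\<Sum>i\<in>{1..n}. \<alpha> ^ (n - i) * bridge \<kappa> W (real (k mod b ^ i) * mesh i) \<omega>)"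
proof -
  have B0: "bridge \<kappa> W 0 \<omega> = 0" using assms kappa_0 by (simp add: bridge_def)
  have fr: "frac (real b ^ m * (real k * mesh n)) = 0" if "n \<le> m" for m
  proof -
    have "real b ^ m = real b ^ (m - n) * real b ^ n" using that by (simp flip: power_add)
    then have "real b ^ m * (real k * mesh n) = of_int (int (b ^ (m - n) * k))"
      using b_ge by (simp add: mesh_def)
    then show ?thesis by (simp only: frac_of_int)
  qed
  have "Y (real k * mesh n) \<omega> = (\<Sum>m<n. \<alpha> ^ m * bridge \<kappa> W (frac (real b ^ m * (real k * mesh n))) \<omega>)"
    unfolding wiener_weierstrass_def by (rule suminf_finite) (simp_all add: fr B0 del: frac_eq_0_iff)
  also have "\<dots> = (\<Sum>i\<in>{1..n}. \<alpha> ^ (n - i) * bridge \<kappa> W (frac (real b ^ (n - i) * (real k * mesh n))) \<omega>)"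
    by (rule sum.reindex_bij_witness[of _ "\<lambda>i. n - i" "\<lambda>m. n - m"]) auto
  also have "\<dots> = (\<Sum>i\<in>{1..n}. \<alpha> ^ (n - i) * bridge \<kappa> W (real (k mod b ^ i) * mesh i) \<omega>)"
  proof (intro sum.cong refl)
    fix i assume "i \<in> {1..n}"
    then have "real b ^ (n - i) * (real k * mesh n) = real k * mesh i"
      using b_ge by (simp add: mesh_def power_diff)
    then show "\<alpha> ^ (n - i) * bridge \<kappa> W (frac (real b ^ (n - i) * (real k * mesh n))) \<omega>
        = \<alpha> ^ (n - i) * bridge \<kappa> W (real (k mod b ^ i) * mesh i) \<omega>"
      by (simp only: frac_mesh)
  qed
  finally show ?thesis .
qed

text \<open>In the last cell the right end point is 1 while the residue jumps back to 0; the bridge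
  vanishes at both, so the jump is harmless.\<close>

lemma bridge_next_cell:
  assumes "W 0 \<omega> = 0"
  shows "bridge \<kappa> W (real (Suc k mod b ^ i) * mesh i) \<omega> = bridge \<kappa> W (real (k mod b ^ i) * mesh i + mesh i) \<omega>"
proof (cases "Suc (k mod b ^ i) = b ^ i")
  case True
  then have "real (k mod b ^ i) * mesh i + mesh i = real (b ^ i) * mesh i"
    by (metis add.commute distrib_right mult_1 of_nat_Suc)
  then have "real (k mod b ^ i) * mesh i + mesh i = 1" by (simp add: mesh_mult_power)
  moreover have "Suc k mod b ^ i = 0" using True by (simp add: mod_Suc)
  ultimately show ?thesis using assms kappa_0 kappa_1 by (simp add: bridge_def)
next
  case False
  then have "Suc k mod b ^ i = Suc (k mod b ^ i)" by (simp add: mod_Suc)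
  then show ?thesis by (simp add: algebra_simps)
qed

text \<open>With \<alpha> = b^(-H) the weight \<alpha>^(n-i) equals b^(-nH) * b^(iH). It exactly
  normalises the increment of level i, so all n levels contribute at the same order and the variance
  grows like n.\<close>

lemma Y_increment:
  assumes "W 0 \<omega> = 0"
  shows "Y (real (Suc k) * mesh n) \<omega> - Y (real k * mesh n) \<omega>
    = mesh n powr H * (path_increment n k \<omega> - drift n k * W 1 \<omega>)"
proof -
  let ?r = "\<lambda>i. real (k mod b ^ i) * mesh i"
  have "Y (real (Suc k) * mesh n) \<omega> - Y (real k * mesh n) \<omega>
     = (\<Sum>i\<in>{1..n}. \<alpha> ^ (n - i) * (bridge \<kappa> W (?r i + mesh i) \<omega> - bridge \<kappa> W (?r i) \<omega>))"
    unfolding Y_mesh[OF assms] bridge_next_cell[OF assms] sum_subtractf[symmetric] right_diff_distrib ..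
  also have "\<dots> = (\<Sum>i\<in>{1..n}. mesh n powr H * (cell_increment i (k mod b ^ i) \<omega>
      - mesh i powr (- H) * (\<kappa> (?r i + mesh i) - \<kappa> (?r i)) * W 1 \<omega>))"
  proof (intro sum.cong refl)
    fix i assume "i \<in> {1..n}"
    then have "\<alpha> ^ (n - i) = mesh n powr H * mesh i powr (- H)"
      using b_ge by (simp add: alpha mesh_powr powr_power of_nat_diff algebra_simps flip: powr_add)
    then show "\<alpha> ^ (n - i) * (bridge \<kappa> W (?r i + mesh i) \<omega> - bridge \<kappa> W (?r i) \<omega>)
        = mesh n powr H * (cell_increment i (k mod b ^ i) \<omega>
          - mesh i powr (- H) * (\<kappa> (?r i + mesh i) - \<kappa> (?r i)) * W 1 \<omega>)"
      unfolding bridge_def cell_increment_def by (simp add: algebra_simps)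
  qed
  also have "\<dots> = mesh n powr H * (path_increment n k \<omega> - drift n k * W 1 \<omega>)"
    unfolding path_increment_def drift_def
    by (simp only: sum_distrib_right sum_subtractf[symmetric] sum_distrib_left[symmetric])
  finally show ?thesis .
qed

definition scaled_variation :: "nat \<Rightarrow> 'a \<Rightarrow> real \<Rightarrow> real" where
  "scaled_variation n \<omega> t = (\<Sum>k<nat \<lfloor>t * real b ^ n\<rfloor>.
     \<bar>normalized_increment 1 n k \<omega> - drift n k * W 1 \<omega> / sqrt (real n)\<bar> powr (1 / H)) / real b ^ n"

text \<open>Raised to the power 1 / H, the factor b^(-nH) becomes b^(-n) and turns the sum into an
  average, while sqrt n becomes the normaliser n^(1/(2H)).\<close>

lemma badic_variation_eq:
  assumes "W 0 \<omega> = 0" "0 < n"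
  shows "1 / real n powr (1 / (2 * H)) * badic_variation b (1 / H) n (\<lambda>s. Y s \<omega>) t = scaled_variation n \<omega> t"
proof -
  have "\<bar>Y ((real k + 1) / real b ^ n) \<omega> - Y (real k / real b ^ n) \<omega>\<bar> powr (1 / H)
      = real n powr (1 / (2 * H)) * (\<bar>normalized_increment 1 n k \<omega> - drift n k * W 1 \<omega> / sqrt (real n)\<bar> powr (1 / H) / real b ^ n)"
    for k
  proof -
    let ?x = "normalized_increment 1 n k \<omega> - drift n k * W 1 \<omega> / sqrt (real n)"
    have "Y ((real k + 1) / real b ^ n) \<omega> - Y (real k / real b ^ n) \<omega>
        = mesh n powr H * (path_increment n k \<omega> - drift n k * W 1 \<omega>)"
      using Y_increment[OF assms(1), of k n] by (simp add: mesh_def add.commute)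
    also have "path_increment n k \<omega> - drift n k * W 1 \<omega> = sqrt (real n) * ?x"
      using assms(2) by (simp add: normalized_increment_def algebra_simps)
    finally have "\<bar>Y ((real k + 1) / real b ^ n) \<omega> - Y (real k / real b ^ n) \<omega>\<bar>
        = mesh n powr H * (sqrt (real n) * \<bar>?x\<bar>)" by (simp add: abs_mult)
    also have "\<dots> powr (1 / H) = (mesh n powr H) powr (1 / H) * (sqrt (real n) powr (1 / H) * \<bar>?x\<bar> powr (1 / H))"
      by (simp add: powr_mult)
    also have "(mesh n powr H) powr (1 / H) = mesh n" using H_pos mesh_pos[of n] by (simp add: powr_powr)
    also have "sqrt (real n) powr (1 / H) = real n powr (1 / (2 * H))"
      by (simp add: powr_powr flip: powr_half_sqrt)
    finally show ?thesis by (simp add: mesh_def)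
  qed
  then have "badic_variation b (1 / H) n (\<lambda>s. Y s \<omega>) t = real n powr (1 / (2 * H)) * scaled_variation n \<omega> t"
    unfolding badic_variation_def scaled_variation_def by (simp add: sum_distrib_left sum_divide_distrib)
  then show ?thesis using assms(2) by simp
qed

lemma cell_count: "0 \<le> t \<Longrightarrow> t \<le> 1 \<Longrightarrow> nat \<lfloor>t * real b ^ n\<rfloor> \<le> b ^ n"
proof -
  assume t: "0 \<le> t" "t \<le> 1"
  have "t * real b ^ n \<le> 1 * real b ^ n" using t by (intro mult_right_mono) auto
  then have "\<lfloor>t * real b ^ n\<rfloor> \<le> int (b ^ n)" by (simp add: floor_le_iff)
  then show ?thesis by (simp add: nat_le_iff)
qed

lemma cell_count_ratio:
  assumes "0 \<le> t"
  shows "(\<lambda>n. real (nat \<lfloor>t * real b ^ n\<rfloor>) / real b ^ n) \<longlonglongrightarrow> t"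
proof -
  have "(\<lambda>n. (1 / real b) ^ n) \<longlonglongrightarrow> 0" using b_ge by (intro LIMSEQ_power_zero) auto
  then have z: "(\<lambda>n. 1 / real b ^ n) \<longlonglongrightarrow> 0" by (simp add: power_divide)
  have "norm (real (nat \<lfloor>t * real b ^ n\<rfloor>) / real b ^ n - t) \<le> 1 / real b ^ n" for n
  proof -
    have bn: "0 < real b ^ n" using b_ge by simp
    have "0 \<le> t * real b ^ n" using assms by simp
    then have "real (nat \<lfloor>t * real b ^ n\<rfloor>) = of_int \<lfloor>t * real b ^ n\<rfloor>" by simp
    then have "\<bar>real (nat \<lfloor>t * real b ^ n\<rfloor>) - t * real b ^ n\<bar> \<le> 1" by linarith
    then have "\<bar>real (nat \<lfloor>t * real b ^ n\<rfloor>) - t * real b ^ n\<bar> / real b ^ n \<le> 1 / real b ^ n"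
      using bn by (intro divide_right_mono) auto
    moreover have "real (nat \<lfloor>t * real b ^ n\<rfloor>) / real b ^ n - t = (real (nat \<lfloor>t * real b ^ n\<rfloor>) - t * real b ^ n) / real b ^ n"
      using bn by (simp add: field_simps)
    ultimately show ?thesis using bn by (simp add: abs_divide)
  qed
  then have "(\<lambda>n. real (nat \<lfloor>t * real b ^ n\<rfloor>) / real b ^ n - t) \<longlonglongrightarrow> 0"
    by (intro Lim_null_comparison[OF always_eventually z]) blast
  then show ?thesis by (rule Lim_null[THEN iffD2])
qed

lemma AE_scaled_variation_tendsto:
  "AE \<omega> in M. \<forall>t\<in>{0..1}. (\<lambda>n. scaled_variation n \<omega> t)
     \<longlonglongrightarrow> t * (LINT y|std_normal_distribution. \<bar>y\<bar> powr (1 / H))"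
proof -
  let ?N = "\<lambda>t n. nat \<lfloor>t * real b ^ n\<rfloor>"
  \<comment> \<open>Time 0 is left out because the perturbation argument divides by t; there the sum
    is empty.\<close>
  let ?R = "\<rat> \<inter> {0<..1} :: real set"
  obtain c where c: "0 \<le> c" "\<And>n k. \<bar>drift n k\<bar> \<le> c" using drift_bounded by blast
  have "AE \<omega> in M. \<forall>t\<in>?R. \<forall>\<theta>\<in>\<rat>.
      (\<lambda>n. (\<Sum>k<?N t n. cos (normalized_increment \<theta> n k \<omega>) - exp (- 1 * \<theta>\<^sup>2 / 2)) / real b ^ n) \<longlonglongrightarrow> 0"
    by (intro AE_ball_countable[THEN iffD2] ballI countable_rat countable_Int1 AE_normalized_average_tendsto cell_count) auto
  moreover have "AE \<omega> in M. \<forall>t\<in>?R.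
      (\<lambda>n. (\<Sum>k<?N t n. cosh (normalized_increment 1 n k \<omega>) - exp (1 * 1\<^sup>2 / 2)) / real b ^ n) \<longlonglongrightarrow> 0"
    by (intro AE_ball_countable[THEN iffD2] ballI countable_rat countable_Int1 AE_normalized_average_tendsto cell_count) auto
  ultimately show ?thesis
  proof eventually_elim
    case (elim \<omega>)
    let ?m = "LINT y|std_normal_distribution. \<bar>y\<bar> powr (1 / H)"
    have R: "(\<lambda>n. scaled_variation n \<omega> t) \<longlonglongrightarrow> t * ?m" if t: "t \<in> \<rat>" "0 \<le> t" "t \<le> 1" for t
    proof (cases "t = 0")
      case True
      then show ?thesis by (simp add: scaled_variation_def)
    next
      case False
      then have tR: "t \<in> ?R" using t by auto
      have scale: "normalized_increment \<theta> n k \<omega> = \<theta> * normalized_increment 1 n k \<omega>" for \<theta> n k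
        by (simp add: normalized_increment_def)
      have pert: "\<bar>normalized_increment 1 n k \<omega> - drift n k * W 1 \<omega> / sqrt (real n) - normalized_increment 1 n k \<omega>\<bar>
          \<le> c * \<bar>W 1 \<omega>\<bar> * (1 / sqrt (real n))" for n k
      proof -
        have "\<bar>drift n k\<bar> * (\<bar>W 1 \<omega>\<bar> / sqrt (real n)) \<le> c * (\<bar>W 1 \<omega>\<bar> / sqrt (real n))"
          by (intro mult_right_mono c) auto
        then show ?thesis by (simp add: abs_mult abs_divide)
      qed
      have "(\<lambda>n. 1 / sqrt (real n)) \<longlonglongrightarrow> 0"
        by (intro tendsto_divide_0[OF tendsto_const] filterlim_at_top_imp_at_infinity
            filterlim_compose[OF sqrt_at_top filterlim_real_sequentially])
      then have eps: "(\<lambda>n. c * \<bar>W 1 \<omega>\<bar> * (1 / sqrt (real n))) \<longlonglongrightarrow> 0"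
        by (rule tendsto_mult_right_zero)
      show ?thesis unfolding scaled_variation_def
      proof (rule perturbed_moment_tendsto[where z = "\<lambda>n k. normalized_increment 1 n k \<omega>"])
        show "0 < 1 / H" "0 < t" using H_pos t False by auto
        show "0 < real b ^ n" for n using b_ge by simp
        show "(\<lambda>n. real (?N t n) / real b ^ n) \<longlonglongrightarrow> t" using t by (intro cell_count_ratio) simp
        show "(\<lambda>n. (\<Sum>k<?N t n. cos (\<theta> * normalized_increment 1 n k \<omega>) - exp (- \<theta>\<^sup>2 / 2)) / real b ^ n) \<longlonglongrightarrow> 0"
          if "\<theta> \<in> \<rat>" for \<theta>
        proof -
          have "(\<lambda>n. (\<Sum>k<?N t n. cos (normalized_increment \<theta> n k \<omega>) - exp (- 1 * \<theta>\<^sup>2 / 2)) / real b ^ n) \<longlonglongrightarrow> 0"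
            using elim(1) tR that by blast
          then show ?thesis unfolding scale[of \<theta>] by simp
        qed
        show "(\<lambda>n. (\<Sum>k<?N t n. cosh (normalized_increment 1 n k \<omega>) - exp (1 / 2)) / real b ^ n) \<longlonglongrightarrow> 0"
          using elim(2) tR by simp
      qed (rule pert eps)+
    qed
    have mono: "scaled_variation n \<omega> x \<le> scaled_variation n \<omega> y" if "x \<le> y" for n x y
    proof -
      have "?N x n \<le> ?N y n" using that by (intro nat_mono floor_mono mult_right_mono) auto
      then show ?thesis unfolding scaled_variation_def
        by (intro divide_right_mono sum_mono2) auto
    qed
    show ?case by (intro ballI tendsto_linear_of_mono_Rats[OF R mono]) auto
  qed
qed

end

theorem theorem2p2:
  fixes M :: "'a measure" and H \<tau> \<alpha> :: real and b :: nat
    and \<kappa> :: "real \<Rightarrow> real" and W Y :: "real \<Rightarrow> 'a \<Rightarrow> real"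
  assumes "prob_space M"
    and "0 < H" and "H < 1"
    and "continuous_fBm M H W"
    and "\<kappa> ` {0..1} \<subseteq> {0..1}" and "\<kappa> 0 = 0" and "\<kappa> 1 = 1"
    and "H < \<tau>" and "\<tau> \<le> 1" and "holder_on \<tau> {0..1} \<kappa>"
    and "0 < \<alpha>" and "\<alpha> < 1" and "2 \<le> b"
    and "Y = wiener_weierstrass \<alpha> b (bridge \<kappa> W)"
    and "H = weierstrass_exponent \<alpha> b"
  shows "(AE \<omega> in M. \<forall>t\<in>{0..1}.
            (\<lambda>n. 1 / real n powr (1 / (2 * H)) * badic_variation b (1 / H) n (\<lambda>s. Y s \<omega>) t)
              \<longlonglongrightarrow> 2 powr (1 / (2 * H)) * Gamma ((H + 1) / (2 * H)) / sqrt pi * t)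
       \<and> (AE \<omega> in M. \<forall>t\<in>{0<..1}.
            filterlim (\<lambda>n. badic_variation b (1 / H) n (\<lambda>s. Y s \<omega>) t) at_top sequentially)"
proof -
  interpret prob_space M by fact
  have alpha: "\<alpha> = real b powr (- H)"
  proof -
    have "H = - log (real b) \<alpha>"
      using assms(15) \<open>H < 1\<close> unfolding weierstrass_exponent_def by linarith
    then have "log (real b) \<alpha> = - H" by linarith
    then show ?thesis using powr_log_cancel[of "real b" \<alpha>] \<open>0 < \<alpha>\<close> \<open>2 \<le> b\<close> by simp
  qed
  interpret wiener_weierstrass_bridge M H b W \<kappa> \<tau> \<alpha>
    by unfold_locales (rule assms alpha)+
  let ?c = "2 powr (1 / (2 * H)) * Gamma ((H + 1) / (2 * H)) / sqrt pi"
  let ?V = "\<lambda>\<omega> t n. badic_variation b (1 / H) n (\<lambda>s. Y s \<omega>) t"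
  have "(1 / H + 1) / 2 = (H + 1) / (2 * H)" "1 / H / 2 = 1 / (2 * H)"
    using \<open>0 < H\<close> by (simp_all add: field_simps)
  then have c: "(LINT y|std_normal_distribution. \<bar>y\<bar> powr (1 / H)) = ?c"
    using integral_std_normal_abs_powr(1)[of "1 / H"] \<open>0 < H\<close> by (simp only: zero_less_divide_1_iff)
  have Y_eq: "Y = wiener_weierstrass \<alpha> b (bridge \<kappa> W)" by fact
  have main: "AE \<omega> in M. \<forall>t\<in>{0..1}. (\<lambda>n. 1 / real n powr (1 / (2 * H)) * ?V \<omega> t n) \<longlonglongrightarrow> ?c * t"
    using AE_scaled_variation_tendsto AE_W_0
  proof eventually_elim
    case (elim \<omega>)
    show ?case
    proof
      fix t :: real assume "t \<in> {0..1}"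
      then have "(\<lambda>n. scaled_variation n \<omega> t) \<longlonglongrightarrow> ?c * t"
        using elim(1) by (simp add: c mult.commute)
      moreover have "\<forall>\<^sub>F n in sequentially. scaled_variation n \<omega> t = 1 / real n powr (1 / (2 * H)) * ?V \<omega> t n"
        using eventually_gt_at_top[of 0]
        by eventually_elim (simp only: Y_eq badic_variation_eq[OF elim(2)])
      ultimately show "(\<lambda>n. 1 / real n powr (1 / (2 * H)) * ?V \<omega> t n) \<longlonglongrightarrow> ?c * t"
        by (rule Lim_transform_eventually)
    qed
  qed
  moreover from main have "AE \<omega> in M. \<forall>t\<in>{0<..1}. filterlim (?V \<omega> t) at_top sequentially"
  proof eventually_elim
    case (elim \<omega>)
    show ?case
    proof
      fix t :: real assume t: "t \<in> {0<..1}"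
      \<comment> \<open>Divergence rests on a strictly positive limit: the unscaled variation is the
        convergent quantity times n^(1/(2H)).\<close>
      have "0 < ?c * t" using t \<open>0 < H\<close> by (intro mult_pos_pos divide_pos_pos Gamma_real_pos) auto
      moreover have "(\<lambda>n. 1 / real n powr (1 / (2 * H)) * ?V \<omega> t n) \<longlonglongrightarrow> ?c * t" using elim t by auto
      moreover have "filterlim (\<lambda>n. real n powr (1 / (2 * H))) at_top sequentially"
      proof (rule filterlim_at_top_mono)
        show "filterlim (\<lambda>n. exp (1 / (2 * H) * ln (real n))) at_top sequentially"
          using \<open>0 < H\<close>
          by (intro filterlim_compose[OF exp_at_top] filterlim_tendsto_pos_mult_at_top[OF tendsto_const]
              filterlim_compose[OF ln_at_top filterlim_real_sequentially]) auto
        show "\<forall>\<^sub>F n in sequentially. exp (1 / (2 * H) * ln (real n)) \<le> real n powr (1 / (2 * H))"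
          using eventually_gt_at_top[of 0] by eventually_elim (simp add: powr_def)
      qed
      ultimately have "filterlim (\<lambda>n. (1 / real n powr (1 / (2 * H)) * ?V \<omega> t n) * real n powr (1 / (2 * H))) at_top sequentially"
        by (intro filterlim_tendsto_pos_mult_at_top)
      moreover have "\<forall>\<^sub>F n in sequentially.
          (1 / real n powr (1 / (2 * H)) * ?V \<omega> t n) * real n powr (1 / (2 * H)) = ?V \<omega> t n"
        using eventually_gt_at_top[of 0] by eventually_elim simp
      ultimately show "filterlim (?V \<omega> t) at_top sequentially"
        by (subst (asm) filterlim_cong[OF refl refl]) 
    qed
  qed
  ultimately show ?thesis by blast
qed

end
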